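(* The operations $$F_b\cdot F_t=\sum_{b\overset{+}{\to}(b_0,\dots,b_m)}F_{(b_0,\dots,b_m)/t}\qquad(b\in\mathcal M_+,\ t\in\mathcal Y_m),\qquad\qquad \boldsymbol\rho_+(F_b)=\sum_{b\overset{+}{\to}(b_0,b_1)}F_{b_0}\otimes F_{\phi(b_1)}\qquad(b\in\mathcal M_+),$$ where the sums are over restricted splittings of $b$, extended linearly to $\mathcal MSym_+\otimes\mathcal YSym\to\mathcal MSym_+$ and $\mathcal MSym_+\to\mathcal MSym_+\otimes\mathcal YSym$, define a (right) $\mathcal YSym$–Hopf module structure on $\mathcal MSym_+$.
   Context: Trees. $\mathcal Y_n$ is the set of rooted planar binary trees with $n$ internal nodes; $|$ is the tree with no nodes; $t_\ell\vee t_r$ is the tree whose root node has left and right subtrees $t_\ell,t_r$. A tree in $\mathcal Y_n$ has leaves numbered $0,\dots,n$ and nodes numbered $1,\dots,n$ from left to right (node $i$ is the gap between leaves $i-1$ and $i$). Its node poset has the internal edges as Hasse diagram and the root as maximum. Splitting and grafting. A splitting of $t\in\mathcal Y_n$ along a multiset $0\le i_1\le\dots\le i_m\le n$ of $m$ leaves, $t\to(t_0,\dots,t_m)$, is obtained by cutting along the paths from these leaves to the root (a leaf of multiplicity $k$ is duplicated $k$ times); $t_j$ contains the nodes $i$ with $i_j<i\le i_{j+1}$ (where $i_0=0$, $i_{m+1}=n$). For $m=1$: $|\to(|,|)$; for $t=a\vee c$, $a\in\mathcal Y_p$, if $i\le p$ and $a\to(a_0,a_1)$ along leaf $i$ then $t\to(a_0,a_1\vee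 c)$, while if $i>p$ and $c\to(c_0,c_1)$ along leaf $i-p-1$ then $t\to(a\vee c_0,c_1)$; the general splitting is obtained by iterating. For $s\in\mathcal Y_m$, $(t_0,\dots,t_m)/s$ is obtained by grafting the root of $t_j$ onto leaf $j$ of $s$ for each $j=0,\dots,m$. Loday–Ronco Hopf algebra. $\mathcal YSym$ is the graded $\mathbb Q$-vector space with basis $\{F_t\mid t\in\mathcal Y_n,n\ge0\}$, coproduct $\Delta F_t=\sum_{t\to(t_0,t_1)}F_{t_0}\otimes F_{t_1}$, product $F_t\cdot F_s=\sum_{t\to(t_0,\dots,t_m)}F_{(t_0,\dots,t_m)/s}$ for $s\in\mathcal Y_m$, unit $1=F_|$, and counit the projection to degree $0$; it is a graded connected Hopf algebra. Sums are over all splittings (choices of multisets of leaves). Bi-leveled trees. A bi-leveled tree with $n\ge1$ nodes is a pair $b=(t;\mathsf T)$ with $t\in\mathcal Y_n$ and $\mathsf T\subseteq\{1,\dots,n\}$ an upper order ideal of the node poset of $t$ containing the leftmost node (node $1$) as a minimal element of $\mathsf T$. $\mathcal M_n$ is the set of these and $\mathcal M_+=\bigsqcup_{n\ge1}\mathcal M_n$. $\mathcal MSym_+$ is the graded $\mathbb Q$-vector space with basis $\{F_b\mid b\in\mathcal M_+\}$. A splitting $t\to(t_0,\dots,t_m)$ induces $b\to(b_0,\dots,b_m)$ with $b_j=(t_j;\mathsf T|_{t_j})$, where $\mathsf T|_{t_j}$ is the set of nodes of $t_j$ coming from $\mathsf T$; $\phi(b_j)=t_j$ denotes the underlying tree.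 The splitting is restricted, written $b\overset{+}{\to}(b_0,\dots,b_m)$, if $b_0\ne|$ (then $b_0\in\mathcal M_+$). For a restricted splitting and $s\in\mathcal Y_m$, $(b_0,\dots,b_m)/s$ is the bi-leveled tree with underlying tree $(t_0,\dots,t_m)/s$ and order ideal consisting of all nodes of $s$ together with the nodes coming from $\mathsf T$. A right Hopf module over a Hopf algebra $H$ is a right $H$-module and right $H$-comodule $N$ with coaction $\rho$ satisfying $\rho(n\cdot h)=\rho(n)\cdot\Delta(h)$ for all $n\in N$, $h\in H$. *)

theory Defs
  imports Complex_Main "HOL-Library.Poly_Mapping"
begin

section \<open>Vector spaces with a basis\<close>

text \<open>
  The vector space with basis \<open>'a\<close> over the field \<open>'k\<close> is the type \<open>'a \<Rightarrow>\<^sub>0 'k\<close> of finitely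
  supported functions, with basis vectors \<open>Poly_Mapping.single a 1\<close>.  The tensor product of the
  spaces with bases \<open>'a\<close> and \<open>'b\<close> is the space with basis \<open>'a \<times> 'b\<close>.
\<close>

abbreviation basis_vec :: "'a \<Rightarrow> ('a \<Rightarrow>\<^sub>0 'k::field)" where
  "basis_vec a \<equiv> Poly_Mapping.single a 1"

definition scl :: "'k::field \<Rightarrow> ('a \<Rightarrow>\<^sub>0 'k) \<Rightarrow> ('a \<Rightarrow>\<^sub>0 'k)" where
  "scl c x = Poly_Mapping.map ((*) c) x"

lemma lookup_scl [simp]: "Poly_Mapping.lookup (scl c x) a = c * Poly_Mapping.lookup x a"
  by (simp add: scl_def Poly_Mapping.map.rep_eq when_def)

interpretation scl: vector_space scl
  by unfold_locales (auto intro!: poly_mapping_eqI simp: lookup_add algebra_simps)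

abbreviation linear_map :: "(('a \<Rightarrow>\<^sub>0 'k::field) \<Rightarrow> ('b \<Rightarrow>\<^sub>0 'k)) \<Rightarrow> bool" where
  "linear_map \<equiv> Vector_Spaces.linear scl scl"

abbreviation linear_form :: "(('a \<Rightarrow>\<^sub>0 'k::field) \<Rightarrow> 'k) \<Rightarrow> bool" where
  "linear_form \<equiv> Vector_Spaces.linear scl (*)"

definition lin_ext :: "('a \<Rightarrow> ('b \<Rightarrow>\<^sub>0 'k)) \<Rightarrow> ('a \<Rightarrow>\<^sub>0 'k::field) \<Rightarrow> ('b \<Rightarrow>\<^sub>0 'k)" where
  "lin_ext f x = (\<Sum>a\<in>Poly_Mapping.keys x. scl (Poly_Mapping.lookup x a) (f a))"

lemma lin_ext_basis_vec [simp]: "lin_ext f (basis_vec a) = f a"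
  by (simp add: lin_ext_def)

definition tensor :: "('a \<Rightarrow>\<^sub>0 'k::field) \<Rightarrow> ('b \<Rightarrow>\<^sub>0 'k) \<Rightarrow> ('a \<times> 'b \<Rightarrow>\<^sub>0 'k)"  (infixr "\<otimes>" 75) where
  "x \<otimes> y = lin_ext (\<lambda>a. lin_ext (\<lambda>b. basis_vec (a, b)) y) x"

lemma tensor_basis_vec [simp]: "basis_vec a \<otimes> basis_vec b = basis_vec (a, b)"
  by (simp add: tensor_def)

text \<open>The tensor product of two linear maps.\<close>

definition tensor_map ::
  "(('a \<Rightarrow>\<^sub>0 'k::field) \<Rightarrow> ('c \<Rightarrow>\<^sub>0 'k)) \<Rightarrow> (('b \<Rightarrow>\<^sub>0 'k) \<Rightarrow> ('d \<Rightarrow>\<^sub>0 'k))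
    \<Rightarrow> ('a \<times> 'b \<Rightarrow>\<^sub>0 'k) \<Rightarrow> ('c \<times> 'd \<Rightarrow>\<^sub>0 'k)" where
  "tensor_map f g = lin_ext (\<lambda>(a, b). f (basis_vec a) \<otimes> g (basis_vec b))"

text \<open>The canonical isomorphisms \<open>(U \<otimes> V) \<otimes> W \<cong> U \<otimes> (V \<otimes> W)\<close>,
  \<open>(U \<otimes> V) \<otimes> (W \<otimes> X) \<cong> (U \<otimes> W) \<otimes> (V \<otimes> X)\<close>, and the maps \<open>V \<otimes> W \<rightarrow> V\<close>, \<open>V \<otimes> W \<rightarrow> W\<close> obtained
  by applying a linear form to the other factor.\<close>

definition tensor_assoc :: "(('a \<times> 'b) \<times> 'c \<Rightarrow>\<^sub>0 'k::field) \<Rightarrow> ('a \<times> 'b \<times> 'c \<Rightarrow>\<^sub>0 'k)" where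
  "tensor_assoc = lin_ext (\<lambda>((a, b), c). basis_vec (a, b, c))"

definition tensor_exchange ::
  "(('a \<times> 'b) \<times> ('c \<times> 'd) \<Rightarrow>\<^sub>0 'k::field) \<Rightarrow> (('a \<times> 'c) \<times> ('b \<times> 'd) \<Rightarrow>\<^sub>0 'k)" where
  "tensor_exchange = lin_ext (\<lambda>((a, b), (c, d)). basis_vec ((a, c), (b, d)))"

definition contract_right :: "(('b \<Rightarrow>\<^sub>0 'k) \<Rightarrow> 'k) \<Rightarrow> ('a \<times> 'b \<Rightarrow>\<^sub>0 'k::field) \<Rightarrow> ('a \<Rightarrow>\<^sub>0 'k)" where
  "contract_right e = lin_ext (\<lambda>(a, b). scl (e (basis_vec b)) (basis_vec a))"

definition contract_left :: "(('a \<Rightarrow>\<^sub>0 'k) \<Rightarrow> 'k) \<Rightarrow> ('a \<times> 'b \<Rightarrow>\<^sub>0 'k::field) \<Rightarrow> ('b \<Rightarrow>\<^sub>0 'k)" where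
  "contract_left e = lin_ext (\<lambda>(a, b). scl (e (basis_vec a)) (basis_vec b))"


section \<open>Hopf algebras and Hopf modules\<close>

text \<open>Multiplications and actions are linear maps on the tensor product.  Being a Hopf algebra is
  part of \<open>right_hopf_module\<close>.\<close>

locale unital_algebra =
  fixes mult :: "('h \<times> 'h \<Rightarrow>\<^sub>0 'k::field) \<Rightarrow> ('h \<Rightarrow>\<^sub>0 'k)"
    and unit :: "'h \<Rightarrow>\<^sub>0 'k"
  assumes mult_linear: "linear_map mult"
    and mult_assoc: "mult (mult (x \<otimes> y) \<otimes> z) = mult (x \<otimes> mult (y \<otimes> z))"
    and mult_unit_left: "mult (unit \<otimes> x) = x"
    and mult_unit_right: "mult (x \<otimes> unit) = x"

locale coalgebra =
  fixes comult :: "('h \<Rightarrow>\<^sub>0 'k::field) \<Rightarrow> ('h \<times> 'h \<Rightarrow>\<^sub>0 'k)"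
    and counit :: "('h \<Rightarrow>\<^sub>0 'k) \<Rightarrow> 'k"
  assumes comult_linear: "linear_map comult"
    and counit_linear: "linear_form counit"
    and coassoc: "tensor_assoc (tensor_map comult id (comult x)) = tensor_map id comult (comult x)"
    and counit_left: "contract_left counit (comult x) = x"
    and counit_right: "contract_right counit (comult x) = x"

locale bialgebra = unital_algebra mult unit + coalgebra comult counit
  for mult :: "('h \<times> 'h \<Rightarrow>\<^sub>0 'k::field) \<Rightarrow> ('h \<Rightarrow>\<^sub>0 'k)"
    and unit :: "'h \<Rightarrow>\<^sub>0 'k"
    and comult :: "('h \<Rightarrow>\<^sub>0 'k) \<Rightarrow> ('h \<times> 'h \<Rightarrow>\<^sub>0 'k)"
    and counit :: "('h \<Rightarrow>\<^sub>0 'k) \<Rightarrow> 'k" +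
  assumes comult_mult:
      "comult (mult (x \<otimes> y)) = tensor_map mult mult (tensor_exchange (comult x \<otimes> comult y))"
    and comult_unit: "comult unit = unit \<otimes> unit"
    and counit_mult: "counit (mult (x \<otimes> y)) = counit x * counit y"
    and counit_unit: "counit unit = 1"

locale hopf_algebra = bialgebra mult unit comult counit
  for mult :: "('h \<times> 'h \<Rightarrow>\<^sub>0 'k::field) \<Rightarrow> ('h \<Rightarrow>\<^sub>0 'k)"
    and unit :: "'h \<Rightarrow>\<^sub>0 'k"
    and comult :: "('h \<Rightarrow>\<^sub>0 'k) \<Rightarrow> ('h \<times> 'h \<Rightarrow>\<^sub>0 'k)"
    and counit :: "('h \<Rightarrow>\<^sub>0 'k) \<Rightarrow> 'k" +
  assumes antipode: "\<exists>S. linear_map S \<and>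
      (\<forall>x. mult (tensor_map S id (comult x)) = scl (counit x) unit \<and>
           mult (tensor_map id S (comult x)) = scl (counit x) unit)"

locale right_module = unital_algebra mult unit
  for mult :: "('h \<times> 'h \<Rightarrow>\<^sub>0 'k::field) \<Rightarrow> ('h \<Rightarrow>\<^sub>0 'k)"
    and unit :: "'h \<Rightarrow>\<^sub>0 'k" +
  fixes act :: "('n \<times> 'h \<Rightarrow>\<^sub>0 'k) \<Rightarrow> ('n \<Rightarrow>\<^sub>0 'k)"
  assumes act_linear: "linear_map act"
    and act_assoc: "act (act (v \<otimes> x) \<otimes> y) = act (v \<otimes> mult (x \<otimes> y))"
    and act_unit: "act (v \<otimes> unit) = v"

locale right_comodule = coalgebra comult counit
  for comult :: "('h \<Rightarrow>\<^sub>0 'k::field) \<Rightarrow> ('h \<times> 'h \<Rightarrow>\<^sub>0 'k)"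
    and counit :: "('h \<Rightarrow>\<^sub>0 'k) \<Rightarrow> 'k" +
  fixes coact :: "('n \<Rightarrow>\<^sub>0 'k) \<Rightarrow> ('n \<times> 'h \<Rightarrow>\<^sub>0 'k)"
  assumes coact_linear: "linear_map coact"
    and coact_coassoc:
      "tensor_assoc (tensor_map coact id (coact v)) = tensor_map id comult (coact v)"
    and coact_counit: "contract_right counit (coact v) = v"

text \<open>
  In the compatibility axiom \<open>\<rho> (v \<cdot> x) = \<rho> v \<cdot> \<Delta> x\<close> the right hand side uses the action
  \<open>(v \<otimes> y) \<cdot> (x \<otimes> z) = (v \<cdot> x) \<otimes> (y z)\<close> of \<open>H \<otimes> H\<close> on \<open>N \<otimes> H\<close>.
\<close>

locale right_hopf_module =
  hopf_algebra mult unit comult counit +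
  right_module mult unit act +
  right_comodule comult counit coact
  for mult :: "('h \<times> 'h \<Rightarrow>\<^sub>0 'k::field) \<Rightarrow> ('h \<Rightarrow>\<^sub>0 'k)"
    and unit :: "'h \<Rightarrow>\<^sub>0 'k"
    and comult :: "('h \<Rightarrow>\<^sub>0 'k) \<Rightarrow> ('h \<times> 'h \<Rightarrow>\<^sub>0 'k)"
    and counit :: "('h \<Rightarrow>\<^sub>0 'k) \<Rightarrow> 'k"
    and act :: "('n \<times> 'h \<Rightarrow>\<^sub>0 'k) \<Rightarrow> ('n \<Rightarrow>\<^sub>0 'k)"
    and coact :: "('n \<Rightarrow>\<^sub>0 'k) \<Rightarrow> ('n \<times> 'h \<Rightarrow>\<^sub>0 'k)" +
  assumes coact_act:
      "coact (act (v \<otimes> x)) = tensor_map act mult (tensor_exchange (coact v \<otimes> comult x))"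


section \<open>Planar binary trees\<close>

text \<open>\<open>size t\<close> is the number of internal nodes; the nodes of \<open>t\<close> are numbered
  \<open>1, \<dots>, size t\<close> and its leaves \<open>0, \<dots>, size t\<close> from left to right.\<close>

datatype pbt = Leaf | Vee pbt pbt

fun split_leaf :: "pbt \<Rightarrow> nat \<Rightarrow> pbt \<times> pbt" where
  "split_leaf Leaf i = (Leaf, Leaf)"
| "split_leaf (Vee a c) i =
    (if i \<le> size a then (let (a0, a1) = split_leaf a i in (a0, Vee a1 c))
     else (let (c0, c1) = split_leaf c (i - size a - 1) in (Vee a c0, c1)))"

text \<open>The splitting along leaves \<open>i\<^sub>1 \<le> \<dots> \<le> i\<^sub>m\<close> is iterated from left to right; leaf \<open>j \<ge> i\<close> of \<open>t\<close> is
  leaf \<open>j - i\<close> of the right part of the splitting of \<open>t\<close> along \<open>i\<close>.\<close>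

fun split_leaves :: "pbt \<Rightarrow> nat list \<Rightarrow> pbt list" where
  "split_leaves t [] = [t]"
| "split_leaves t (i # is) = (let (t0, u) = split_leaf t i in t0 # split_leaves u (map (\<lambda>j. j - i) is))"

text \<open>Multisets of \<open>m\<close> leaves are encoded as weakly increasing lists.\<close>

definition leaf_multisets :: "pbt \<Rightarrow> nat \<Rightarrow> nat list set" where
  "leaf_multisets t m = {is. length is = m \<and> sorted is \<and> set is \<subseteq> {..size t}}"

lemma finite_leaf_multisets: "finite (leaf_multisets t m)"
  by (rule finite_subset [OF _ finite_lists_length_eq [of "{..size t}" m]])
    (auto simp: leaf_multisets_def)

fun graft :: "pbt list \<Rightarrow> pbt \<Rightarrow> pbt" where
  "graft ts Leaf = hd ts"
| "graft ts (Vee l r) =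
    Vee (graft (take (size l + 1) ts) l) (graft (drop (size l + 1) ts) r)"


section \<open>The Loday--Ronco Hopf algebra\<close>

type_synonym ysym = "pbt \<Rightarrow>\<^sub>0 rat"

definition ysym_mult :: "(pbt \<times> pbt \<Rightarrow>\<^sub>0 rat) \<Rightarrow> ysym" where
  "ysym_mult = lin_ext (\<lambda>(t, s). \<Sum>is\<in>leaf_multisets t (size s). basis_vec (graft (split_leaves t is) s))"

definition ysym_unit :: ysym where
  "ysym_unit = basis_vec Leaf"

definition ysym_comult :: "ysym \<Rightarrow> (pbt \<times> pbt \<Rightarrow>\<^sub>0 rat)" where
  "ysym_comult = lin_ext (\<lambda>t. \<Sum>is\<in>leaf_multisets t 1. basis_vec (split_leaves t is ! 0, split_leaves t is ! 1))"

definition ysym_counit :: "ysym \<Rightarrow> rat" where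
  "ysym_counit x = Poly_Mapping.lookup x Leaf"


section \<open>Bi-leveled trees\<close>

text \<open>The edges between internal nodes, directed towards the root; node \<open>i\<close> of the right subtree
  of \<open>Vee l r\<close> is node \<open>i + size l + 1\<close> of \<open>Vee l r\<close>.\<close>

fun root_node :: "pbt \<Rightarrow> nat" where
  "root_node Leaf = 0"
| "root_node (Vee l r) = size l + 1"

fun edges :: "pbt \<Rightarrow> (nat \<times> nat) set" where
  "edges Leaf = {}"
| "edges (Vee l r) =
    edges l \<union> (\<lambda>(i, j). (i + size l + 1, j + size l + 1)) ` edges r \<union>
    (if l = Leaf then {} else {(root_node l, size l + 1)}) \<union>
    (if r = Leaf then {} else {(root_node r + size l + 1, size l + 1)})"

definition node_le :: "pbt \<Rightarrow> nat \<Rightarrow> nat \<Rightarrow> bool" where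
  "node_le t i j \<longleftrightarrow> i \<in> {1..size t} \<and> j \<in> {1..size t} \<and> (i, j) \<in> (edges t)\<^sup>*"

definition upper_ideal :: "pbt \<Rightarrow> nat set \<Rightarrow> bool" where
  "upper_ideal t T \<longleftrightarrow> T \<subseteq> {1..size t} \<and> (\<forall>i j. i \<in> T \<longrightarrow> node_le t i j \<longrightarrow> j \<in> T)"

definition bileveled :: "pbt \<times> nat set \<Rightarrow> bool" where
  "bileveled = (\<lambda>(t, T). upper_ideal t T \<and> 1 \<in> T \<and> (\<forall>i\<in>T. node_le t i 1 \<longrightarrow> i = 1))"

text \<open>In \<open>bsplit\<close>, node \<open>i\<close> of the part starting at leaf \<open>k\<close> comes from node \<open>i + k\<close>.\<close>

definition bsplit :: "pbt \<times> nat set \<Rightarrow> nat list \<Rightarrow> (pbt \<times> nat set) list" where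
  "bsplit = (\<lambda>(t, T) is.
    map2 (\<lambda>u k. (u, {i \<in> {1..size u}. i + k \<in> T})) (split_leaves t is) (0 # is))"

definition restricted_leaf_multisets :: "pbt \<Rightarrow> nat \<Rightarrow> nat list set" where
  "restricted_leaf_multisets t m = {is \<in> leaf_multisets t m. split_leaves t is ! 0 \<noteq> Leaf}"

text \<open>Read from left to right, the nodes of \<open>(t\<^sub>0, \<dots>, t\<^sub>m)/s\<close> are those of \<open>t\<^sub>0\<close>, node \<open>1\<close> of \<open>s\<close>, the
  nodes of \<open>t\<^sub>1\<close>, node \<open>2\<close> of \<open>s\<close>, and so on: node \<open>j\<close> of \<open>s\<close> becomes node \<open>offset [t\<^sub>0, \<dots>, t\<^sub>m] j\<close>, and
  node \<open>i\<close> of \<open>t\<^sub>j\<close> becomes node \<open>i + offset [t\<^sub>0, \<dots>, t\<^sub>m] j\<close>.\<close>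

definition offset :: "pbt list \<Rightarrow> nat \<Rightarrow> nat" where
  "offset ts j = (\<Sum>l<j. size (ts ! l) + 1)"

definition bgraft :: "(pbt \<times> nat set) list \<Rightarrow> pbt \<Rightarrow> pbt \<times> nat set" where
  "bgraft bs s = (graft (map fst bs) s,
    offset (map fst bs) ` {1..size s} \<union>
    (\<Union>j\<le>size s. (\<lambda>i. i + offset (map fst bs) j) ` snd (bs ! j)))"


subsection \<open>Restricted splittings and graftings are bi-leveled\<close>

lemma edges_range: "(i, j) \<in> edges t \<Longrightarrow> i \<in> {1..size t} \<and> j \<in> {1..size t} \<and> i \<noteq> j"
proof (induction t arbitrary: i j)
  case Leaf
  then show ?case by simp
next
  case (Vee l r)
  have "t \<noteq> Leaf \<Longrightarrow> root_node t \<in> {1..size t}" for t by (cases t) auto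
  with Vee show ?case by (fastforce split: if_splits)
qed

lemma root_node_max: "i \<in> {1..size t} \<Longrightarrow> (i, root_node t) \<in> (edges t)\<^sup>*"
proof (induction t arbitrary: i)
  case Leaf
  then show ?case by simp
next
  case (Vee l r)
  let ?sh = "\<lambda>i. i + size l + 1"
  consider "i \<in> {1..size l}" | "i = size l + 1" | i' where "i = ?sh i'" "i' \<in> {1..size r}"
  proof -
    have "i = ?sh (i - (size l + 1))" "i - (size l + 1) \<in> {1..size r}" if "i > size l + 1"
      using Vee.prems that by auto
    then show thesis using that Vee.prems by (metis atLeastAtMost_iff linorder_neqE_nat
        Suc_eq_plus1 less_Suc_eq_le)
  qed
  then show ?case
  proof cases
    case 1
    then have "l \<noteq> Leaf" by auto
    have "(i, root_node l) \<in> (edges (Vee l r))\<^sup>*"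
      by (rule subsetD [OF rtrancl_mono Vee.IH(1) [OF 1]]) auto
    also have "(root_node l, size l + 1) \<in> edges (Vee l r)" using \<open>l \<noteq> Leaf\<close> by simp
    finally show ?thesis by simp
  next
    case 2
    then show ?thesis by simp
  next
    case 3
    then have "r \<noteq> Leaf" by auto
    have "(?sh x, ?sh y) \<in> (edges (Vee l r))\<^sup>*" if "(x, y) \<in> (edges r)\<^sup>*" for x y
      using that
    proof induction
      case (step y z)
      then have "(?sh y, ?sh z) \<in> edges (Vee l r)" by force
      with step.IH show ?case by (rule rtrancl_into_rtrancl)
    qed simp
    with Vee.IH(2) 3 have "(i, ?sh (root_node r)) \<in> (edges (Vee l r))\<^sup>*" by blast
    also have "(?sh (root_node r), size l + 1) \<in> edges (Vee l r)" using \<open>r \<noteq> Leaf\<close> by simp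
    finally show ?thesis by simp
  qed
qed

lemma rtrancl_shift:
  assumes "\<And>x y. (x, y) \<in> E \<Longrightarrow> (x + k, y + k) \<in> F\<^sup>*" "(x, y) \<in> E\<^sup>*"
  shows "(x + k, y + k :: nat) \<in> F\<^sup>*"
  using assms(2) by induction (auto intro: rtrancl_trans assms(1))

lemma edges_left: "(x, y) \<in> (edges l)\<^sup>* \<Longrightarrow> (x, y) \<in> (edges (Vee l r))\<^sup>*"
  by (rule subsetD [OF rtrancl_mono]) auto

lemma edges_right:
  "(x, y) \<in> (edges r)\<^sup>* \<Longrightarrow> (x + (size l + 1), y + (size l + 1)) \<in> (edges (Vee l r))\<^sup>*"
proof (rule rtrancl_shift)
  fix x y assume "(x, y) \<in> edges r"
  then have "(x + (size l + 1), y + (size l + 1)) \<in> edges (Vee l r)" by force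
  then show "(x + (size l + 1), y + (size l + 1)) \<in> (edges (Vee l r))\<^sup>*" by blast
qed

lemma size_split_leaf: "i \<le> size t \<Longrightarrow> split_leaf t i = (u, v) \<Longrightarrow> size u = i \<and> size v = size t - i"
proof (induction t arbitrary: i u v)
  case (Vee l r)
  show ?case
  proof (cases "i \<le> size l")
    case True
    obtain a0 a1 where a: "split_leaf l i = (a0, a1)" by fastforce
    show ?thesis using Vee.IH(1) [OF True a] Vee.prems True a by auto
  next
    case False
    then have le: "i - size l - 1 \<le> size r" using Vee.prems by simp
    obtain c0 c1 where c: "split_leaf r (i - size l - 1) = (c0, c1)" by fastforce
    show ?thesis using Vee.IH(2) [OF le c] Vee.prems False c by auto
  qed
qed simp

lemma root_node_range: "t \<noteq> Leaf \<Longrightarrow> root_node t \<in> {1..size t}"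
  by (cases t) auto

lemma edges_split_leaf:
  assumes "i \<le> size t" "split_leaf t i = (u, v)"
  shows "(x, y) \<in> edges u \<Longrightarrow> (x, y) \<in> (edges t)\<^sup>*"
    and "(x, y) \<in> edges v \<Longrightarrow> (x + i, y + i) \<in> (edges t)\<^sup>*"
proof -
  have "((x, y) \<in> edges u \<longrightarrow> (x, y) \<in> (edges t)\<^sup>*) \<and>
        ((x, y) \<in> edges v \<longrightarrow> (x + i, y + i) \<in> (edges t)\<^sup>*)"
    using assms
  proof (induction t arbitrary: i u v x y)
    case Leaf
    then show ?case by simp
  next
    case (Vee a c)
    let ?p = "size a + 1"
    have max: "(x, ?p) \<in> (edges (Vee a c))\<^sup>*" if "x \<in> {1..size (Vee a c)}" for x
      using root_node_max [OF that] by simp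
    show ?case
    proof (cases "i \<le> size a")
      case True
      obtain a1 where a1: "split_leaf a i = (u, a1)" "v = Vee a1 c"
        using Vee.prems True by (auto split: prod.splits)
      note IH = Vee.IH(1) [OF True a1(1)]
      note sz = size_split_leaf [OF True a1(1)]
      show ?thesis
      proof (intro conjI impI)
        assume "(x, y) \<in> edges u"
        with IH edges_left show "(x, y) \<in> (edges (Vee a c))\<^sup>*" by blast
      next
        assume "(x, y) \<in> edges v"
        then consider "(x, y) \<in> edges a1"
          | x' y' where "(x', y') \<in> edges c" "x = x' + size a1 + 1" "y = y' + size a1 + 1"
          | "a1 \<noteq> Leaf" "x = root_node a1" "y = size a1 + 1"
          | "c \<noteq> Leaf" "x = root_node c + size a1 + 1" "y = size a1 + 1"
          unfolding a1 by (auto split: if_splits)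
        then show "(x + i, y + i) \<in> (edges (Vee a c))\<^sup>*"
        proof cases
          case 1
          with IH edges_left show ?thesis by blast
        next
          case 2
          have "x + i = x' + ?p" "y + i = y' + ?p" using 2 sz True by auto
          with edges_right [OF r_into_rtrancl [OF 2(1)]] show ?thesis by metis
        next
          case 3
          have "y + i = ?p" using 3 sz True by auto
          moreover have "x + i \<in> {1..size (Vee a c)}"
            using root_node_range [OF 3(1)] 3 sz True by auto
          ultimately show ?thesis using max by metis
        next
          case 4
          have "y + i = ?p" using 4 sz True by auto
          moreover have "x + i \<in> {1..size (Vee a c)}"
            using root_node_range [OF 4(1)] 4 sz True by auto
          ultimately show ?thesis using max by metis
        qed
      qed
    next
      case False
      let ?i = "i - size a - 1"
      obtain c0 where c0: "split_leaf c ?i = (c0, v)" "u = Vee a c0"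
        using Vee.prems False by (auto split: prod.splits)
      have le: "?i \<le> size c" using Vee.prems False by auto
      note IH = Vee.IH(2) [OF le c0(1)]
      note sz = size_split_leaf [OF le c0(1)]
      show ?thesis
      proof (intro conjI impI)
        assume "(x, y) \<in> edges v"
        with IH have "(x + ?i, y + ?i) \<in> (edges c)\<^sup>*" by blast
        from edges_right [OF this, of a] show "(x + i, y + i) \<in> (edges (Vee a c))\<^sup>*"
          using False by (simp add: add.assoc)
      next
        assume "(x, y) \<in> edges u"
        then consider "(x, y) \<in> edges a"
          | x' y' where "(x', y') \<in> edges c0" "x = x' + ?p" "y = y' + ?p"
          | "a \<noteq> Leaf" "x = root_node a" "y = ?p"
          | "c0 \<noteq> Leaf" "x = root_node c0 + ?p" "y = ?p"
          unfolding c0 by (auto split: if_splits)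
        then show "(x, y) \<in> (edges (Vee a c))\<^sup>*"
        proof cases
          case 1
          with edges_left show ?thesis by blast
        next
          case 2
          with IH have "(x', y') \<in> (edges c)\<^sup>*" by blast
          from edges_right [OF this, of a] 2 show ?thesis by simp
        next
          case 3
          with root_node_range [OF 3(1)] max show ?thesis by auto
        next
          case 4
          with root_node_range [OF 4(1)] max [of x] sz le show ?thesis by auto
        qed
      qed
    qed
  qed
  then show "(x, y) \<in> edges u \<Longrightarrow> (x, y) \<in> (edges t)\<^sup>*"
    and "(x, y) \<in> edges v \<Longrightarrow> (x + i, y + i) \<in> (edges t)\<^sup>*" by auto
qed

lemma length_split_leaves [simp]: "length (split_leaves t is) = length is + 1"
proof -
  have "length (split_leaves t is) = length is + 1" if "length is = n" for n t "is"
    using that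
  proof (induction n arbitrary: t "is")
    case (Suc n)
    then obtain i js where "is": "is = i # js" "length js = n" by (cases "is") auto
    obtain t0 u where "split_leaf t i = (t0, u)" by fastforce
    with Suc.IH [of "map (\<lambda>j. j - i) js" u] "is" show ?case by simp
  qed simp
  then show ?thesis by blast
qed

lemma split_parts:
  assumes "sorted is" "set is \<subseteq> {..size t}" "(u, k) \<in> set (zip (split_leaves t is) (0 # is))"
  shows "size u + k \<le> size t \<and> (\<forall>(x, y)\<in>edges u. (x + k, y + k) \<in> (edges t)\<^sup>*)"
  using assms
proof (induction t "is" arbitrary: u k rule: split_leaves.induct)
  case (1 t)
  then show ?case by auto
next
  case (2 t i "is")
  obtain t0 v where tv: "split_leaf t i = (t0, v)" by fastforce
  have i: "i \<le> size t" using 2 by auto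
  note sz = size_split_leaf [OF i tv]
  show ?case
  proof (cases "(u, k) = (t0, 0)")
    case True
    then show ?thesis using sz i edges_split_leaf(1) [OF i tv] by auto
  next
    case False
    let ?is = "map (\<lambda>j. j - i) is"
    have "(u, k) \<in> set (zip (split_leaves v ?is) (i # is))"
      using 2(4) False tv by auto
    moreover have "i # is = map (\<lambda>j. j + i) (0 # ?is)"
      using 2(2) by (auto intro!: map_idI [symmetric] simp: comp_def)
    ultimately obtain k' where k': "(u, k') \<in> set (zip (split_leaves v ?is) (0 # ?is))" "k = k' + i"
      by (auto simp: zip_map2 simp del: list.map)
    have "sorted ?is" using 2(2) by (auto simp: sorted_iff_nth_mono intro: diff_le_mono)
    moreover have "set ?is \<subseteq> {..size v}" using 2(3) sz by auto
    ultimately have IH: "size u + k' \<le> size v" "\<And>x y. (x, y) \<in> edges u \<Longrightarrow> (x + k', y + k') \<in> (edges v)\<^sup>*"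
      using 2(1) [OF tv [symmetric] refl _ _ k'(1)] by auto
    have "(x + k, y + k) \<in> (edges t)\<^sup>*" if "(x, y) \<in> edges u" for x y
      using rtrancl_shift [OF edges_split_leaf(2) [OF i tv] IH(2) [OF that]] k'(2) by (simp add: add.assoc)
    moreover have "size u + k \<le> size t" using IH(1) sz i k'(2) by simp
    ultimately show ?thesis by auto
  qed
qed

lemma upper_ideal_iff:
  "upper_ideal t T \<longleftrightarrow> T \<subseteq> {1..size t} \<and> (\<forall>(i, j)\<in>edges t. i \<in> T \<longrightarrow> j \<in> T)"
proof -
  have up: "j \<in> T" if E: "\<forall>(i, j)\<in>edges t. i \<in> T \<longrightarrow> j \<in> T" and i: "i \<in> T" and ij: "node_le t i j" for i j
  proof -
    have "(i, j) \<in> (edges t)\<^sup>*" using ij by (simp add: node_le_def)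
    then show ?thesis
    proof induction
      case (step y z)
      with E show ?case by blast
    qed (rule i)
  qed
  have le: "node_le t i j" if "(i, j) \<in> edges t" for i j
    using edges_range [OF that] r_into_rtrancl [OF that] by (simp add: node_le_def)
  show ?thesis
  proof
    assume "upper_ideal t T"
    with le show "T \<subseteq> {1..size t} \<and> (\<forall>(i, j)\<in>edges t. i \<in> T \<longrightarrow> j \<in> T)"
      unfolding upper_ideal_def by blast
  next
    assume "T \<subseteq> {1..size t} \<and> (\<forall>(i, j)\<in>edges t. i \<in> T \<longrightarrow> j \<in> T)"
    with up show "upper_ideal t T" unfolding upper_ideal_def by blast
  qed
qed

lemma bileveled_iff:
  "bileveled (t, T) \<longleftrightarrow> upper_ideal t T \<and> 1 \<in> T \<and> (\<forall>i\<in>T. (i, 1) \<notin> edges t)"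
proof -
  have "i = 1" if T: "upper_ideal t T" "\<forall>i\<in>T. (i, 1) \<notin> edges t" and i: "i \<in> T" "node_le t i 1" for i
  proof (rule ccontr)
    assume "i \<noteq> 1"
    moreover have "(i, 1) \<in> (edges t)\<^sup>*" using i by (simp add: node_le_def)
    ultimately obtain k where k: "(i, k) \<in> (edges t)\<^sup>*" "(k, 1) \<in> edges t" by (metis rtranclE)
    have "i \<in> {1..size t}" using T(1) i(1) by (auto simp: upper_ideal_def)
    with k have "node_le t i k" by (auto simp: node_le_def dest: edges_range)
    with T i k show False by (auto simp: upper_ideal_def)
  qed
  moreover have "(i, 1) \<notin> edges t" if "\<forall>i\<in>T. node_le t i 1 \<longrightarrow> i = 1" "i \<in> T" for i
    using that edges_range [of i 1 t] by (auto simp: node_le_def)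
  ultimately show ?thesis unfolding bileveled_def by auto
qed

lemma length_bsplit [simp]: "length (bsplit b is) = length is + 1"
  by (auto simp: bsplit_def split: prod.splits)

lemma map_fst_bsplit [simp]: "map fst (bsplit b is) = split_leaves (fst b) is"
  by (rule nth_equalityI) (auto simp: bsplit_def split_beta)

lemma upper_ideal_bsplit:
  assumes "upper_ideal t T" "is \<in> leaf_multisets t m" "(u, U) \<in> set (bsplit (t, T) is)"
  shows "upper_ideal u U"
proof -
  obtain k where uk: "(u, k) \<in> set (zip (split_leaves t is) (0 # is))"
    and U: "U = {i \<in> {1..size u}. i + k \<in> T}"
    using assms(3) by (auto simp: bsplit_def)
  have *: "size u + k \<le> size t" "\<And>x y. (x, y) \<in> edges u \<Longrightarrow> (x + k, y + k) \<in> (edges t)\<^sup>*"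
    using split_parts [OF _ _ uk] assms(2) by (auto simp: leaf_multisets_def)
  show ?thesis
    unfolding upper_ideal_iff
  proof (intro conjI)
    show "\<forall>(i, j)\<in>edges u. i \<in> U \<longrightarrow> j \<in> U"
    proof clarify
      fix i j assume ij: "(i, j) \<in> edges u" "i \<in> U"
      have r: "i \<in> {1..size u}" "j \<in> {1..size u}" using edges_range [OF ij(1)] by auto
      then have "node_le t (i + k) (j + k)" using * ij(1) by (auto simp: node_le_def)
      with assms(1) ij U r show "j \<in> U" by (auto simp: upper_ideal_def)
    qed
  qed (auto simp: U)
qed

lemma bileveled_bsplit:
  assumes "bileveled b" "is \<in> restricted_leaf_multisets (fst b) m"
  shows "bileveled (bsplit b is ! 0)"
proof -
  obtain t T where b: "b = (t, T)" by fastforce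
  define u where "u = split_leaves t is ! 0"
  have u: "bsplit b is ! 0 = (u, {i \<in> {1..size u}. i \<in> T})"
    by (simp add: bsplit_def b u_def)
  have "is": "is \<in> leaf_multisets t m" "u \<noteq> Leaf"
    using assms(2) by (auto simp: restricted_leaf_multisets_def b u_def)
  have "upper_ideal u {i \<in> {1..size u}. i \<in> T}"
  proof (rule upper_ideal_bsplit)
    show "(u, {i \<in> {1..size u}. i \<in> T}) \<in> set (bsplit (t, T) is)"
      using u b by (metis length_bsplit nth_mem zero_less_one add_pos_nonneg le0 add.commute)
  qed (use assms(1) "is" b in \<open>auto simp: bileveled_def\<close>)
  moreover have "1 \<in> {i \<in> {1..size u}. i \<in> T}"
    using assms(1) "is"(2) by (cases u) (auto simp: b bileveled_def)
  moreover have "(i, 1) \<notin> edges u" if i: "i \<in> T" for i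
  proof
    assume e: "(i, 1) \<in> edges u"
    have "(u, 0) \<in> set (zip (split_leaves t is) (0 # is))"
      by (cases "split_leaves t is") (use length_split_leaves [of t "is"] in \<open>auto simp: u_def\<close>)
    from split_parts [OF _ _ this] "is"(1) e edges_range [OF e]
    have "node_le t i 1" by (fastforce simp: leaf_multisets_def node_le_def)
    with assms(1) i edges_range [OF e] show False by (auto simp: b bileveled_def)
  qed
  ultimately show ?thesis by (simp add: u bileveled_iff)
qed

lemma offset_Suc: "offset ts (Suc j) = offset ts j + size (ts ! j) + 1"
  by (simp add: offset_def)

lemma offset_take: "j \<le> n \<Longrightarrow> n \<le> length ts \<Longrightarrow> offset (take n ts) j = offset ts j"
  by (simp add: offset_def)

lemma offset_drop: "n \<le> length ts \<Longrightarrow> offset ts (j + n) = offset (drop n ts) j + offset ts n"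
  by (induction j) (auto simp: offset_Suc add.commute offset_def)

lemma size_graft: "length ts = size s + 1 \<Longrightarrow> size (graft ts s) + 1 = offset ts (size s + 1)"
proof (induction s arbitrary: ts)
  case Leaf
  then show ?case by (cases ts) (auto simp: offset_def)
next
  case (Vee l r)
  have "size (graft (take (size l + 1) ts) l) + 1 = offset ts (size l + 1)"
    using Vee by (simp add: offset_take)
  moreover have "size (graft (drop (size l + 1) ts) r) + 1 = offset (drop (size l + 1) ts) (size r + 1)"
    using Vee by simp
  ultimately show ?case
    using offset_drop [of "size l + 1" ts "size r + 1"] Vee.prems by (simp add: add_ac)
qed

lemma bgraft_Leaf: "length bs = 1 \<Longrightarrow> bgraft bs Leaf = hd bs"
  by (cases bs) (auto simp: bgraft_def offset_def prod_eq_iff)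

lemma bgraft_Vee:
  assumes "length bs = size (Vee l r) + 1"
    and "bgraft (take (size l + 1) bs) l = (gl, Gl)" "bgraft (drop (size l + 1) bs) r = (gr, Gr)"
  shows "bgraft bs (Vee l r) =
    (Vee gl gr, Gl \<union> {size gl + 1} \<union> (\<lambda>i. i + (size gl + 1)) ` Gr)"
proof -
  let ?n = "size l + 1"
  let ?o = "offset (map fst bs)"
  let ?ol = "offset (map fst (take ?n bs))"
  let ?or = "offset (map fst (drop ?n bs))"
  have gl: "gl = graft (take ?n (map fst bs)) l" and gr: "gr = graft (drop ?n (map fst bs)) r"
    using assms by (auto simp: bgraft_def take_map drop_map)
  have n: "size gl + 1 = ?o ?n"
    using size_graft [of "take ?n (map fst bs)" l] assms(1) by (simp add: gl offset_take)
  have ol: "?ol j = ?o j" if "j \<le> ?n" for j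
    using offset_take [of j ?n "map fst bs"] that assms(1) by (simp add: take_map)
  have or: "?o (j + ?n) = ?or j + ?o ?n" for j
    using offset_drop [of ?n "map fst bs" j] assms(1) by (simp add: drop_map)
  have Gl: "Gl = ?o ` {1..size l} \<union> (\<Union>j\<le>size l. (\<lambda>i. i + ?o j) ` snd (bs ! j))"
  proof -
    have "Gl = ?ol ` {1..size l} \<union> (\<Union>j\<le>size l. (\<lambda>i. i + ?ol j) ` snd (bs ! j))"
      using assms(2) by (simp add: bgraft_def)
    also have "?ol ` {1..size l} = ?o ` {1..size l}"
      by (rule image_cong) (use ol in auto)
    also have "(\<Union>j\<le>size l. (\<lambda>i. i + ?ol j) ` snd (bs ! j)) = (\<Union>j\<le>size l. (\<lambda>i. i + ?o j) ` snd (bs ! j))"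
      by (rule SUP_cong [OF refl]) (use ol in auto)
    finally show ?thesis .
  qed
  have Gr: "Gr = ?or ` {1..size r} \<union> (\<Union>j\<le>size r. (\<lambda>i. i + ?or j) ` snd (bs ! (j + ?n)))"
    using assms(1,3) by (auto simp: bgraft_def add.commute)
  have I: "{1..size (Vee l r)} = {1..size l} \<union> {?n} \<union> (\<lambda>j. j + ?n) ` {1..size r}"
    unfolding image_add_atLeastAtMost' by auto
  have J: "{..size (Vee l r)} = {..size l} \<union> (\<lambda>j. j + ?n) ` {..size r}"
    unfolding atMost_atLeast0 image_add_atLeastAtMost' by auto
  have "?o ` {1..size (Vee l r)} \<union> (\<Union>j\<le>size (Vee l r). (\<lambda>i. i + ?o j) ` snd (bs ! j))
      = Gl \<union> {?o ?n} \<union> (\<lambda>i. i + ?o ?n) ` Gr"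
    unfolding I J Gl Gr image_Un image_UN image_image UN_Un
    by (auto simp only: or add.assoc image_image UN_simps image_Un image_insert image_empty)
  then show ?thesis
    unfolding n bgraft_def by (simp add: gl gr take_map drop_map)
qed

lemma upper_ideal_bgraft:
  assumes "length bs = size s + 1" "\<And>t T. (t, T) \<in> set bs \<Longrightarrow> upper_ideal t T"
  shows "upper_ideal (fst (bgraft bs s)) (snd (bgraft bs s)) \<and>
    (s \<noteq> Leaf \<longrightarrow> root_node (fst (bgraft bs s)) \<in> snd (bgraft bs s))"
  using assms
proof (induction s arbitrary: bs)
  case Leaf
  then show ?case by (cases bs) (auto simp: bgraft_Leaf)
next
  case (Vee l r)
  obtain gl Gl gr Gr
    where g: "bgraft (take (size l + 1) bs) l = (gl, Gl)" "bgraft (drop (size l + 1) bs) r = (gr, Gr)"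
    by fastforce
  have l: "upper_ideal gl Gl"
    using Vee.IH(1) [of "take (size l + 1) bs"] Vee.prems g by (auto dest: in_set_takeD)
  have r: "upper_ideal gr Gr"
    using Vee.IH(2) [of "drop (size l + 1) bs"] Vee.prems g by (auto dest: in_set_dropD)
  show ?case
    using l r unfolding bgraft_Vee [OF Vee.prems(1) g] upper_ideal_iff
    by (fastforce dest: edges_range split: if_splits)
qed

lemma bileveled_bgraft:
  assumes "length bs = size s + 1" "bileveled (bs ! 0)"
    and "\<And>t T. (t, T) \<in> set bs \<Longrightarrow> upper_ideal t T"
  shows "bileveled (bgraft bs s)"
  using assms
proof (induction s arbitrary: bs)
  case Leaf
  then show ?case by (cases bs) (auto simp: bgraft_Leaf)
next
  case (Vee l r)
  obtain gl Gl gr Gr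
    where g: "bgraft (take (size l + 1) bs) l = (gl, Gl)" "bgraft (drop (size l + 1) bs) r = (gr, Gr)"
    by fastforce
  have l: "bileveled (gl, Gl)"
    using Vee.IH(1) [of "take (size l + 1) bs"] Vee.prems g by (auto dest: in_set_takeD)
  then have gl: "1 \<in> Gl" "Gl \<subseteq> {1..size gl}" "\<forall>i\<in>Gl. (i, 1) \<notin> edges gl"
    by (auto simp: bileveled_iff upper_ideal_iff)
  have "upper_ideal gr Gr"
    using upper_ideal_bgraft [of "drop (size l + 1) bs" r] Vee.prems g by (auto dest: in_set_dropD)
  have up: "upper_ideal (Vee gl gr) (Gl \<union> {size gl + 1} \<union> (\<lambda>i. i + (size gl + 1)) ` Gr)"
    using upper_ideal_bgraft [OF Vee.prems(1,3)] unfolding bgraft_Vee [OF Vee.prems(1) g] by simp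
  have "size gl \<ge> 1" using gl by auto
  with gl up show ?case
    unfolding bgraft_Vee [OF Vee.prems(1) g] bileveled_iff
    by (fastforce dest: edges_range split: if_splits)
qed

lemma bileveled_bgraft_bsplit:
  assumes "bileveled b" "is \<in> restricted_leaf_multisets (fst b) (size s)"
  shows "bileveled (bgraft (bsplit b is) s)"
proof (rule bileveled_bgraft)
  show "length (bsplit b is) = size s + 1" using assms(2)
    by (simp add: restricted_leaf_multisets_def leaf_multisets_def)
  show "bileveled (bsplit b is ! 0)" using assms by (rule bileveled_bsplit)
  fix t T assume "(t, T) \<in> set (bsplit b is)"
  with assms show "upper_ideal t T"
    by (cases b) (auto simp: restricted_leaf_multisets_def bileveled_def intro: upper_ideal_bsplit)
qed


section \<open>The module \<open>MSym\<^sub>+\<close>\<close>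

typedef mtree = "{b. bileveled b}"
proof
  show "(Vee Leaf Leaf, {1}) \<in> {b. bileveled b}" by (auto simp: bileveled_iff upper_ideal_iff)
qed

type_synonym msym = "mtree \<Rightarrow>\<^sub>0 rat"

definition underlying_tree :: "mtree \<Rightarrow> pbt" where
  "underlying_tree b = fst (Rep_mtree b)"

text \<open>The arguments of \<open>Abs_mtree\<close> below are bi-leveled by \<open>bileveled_bgraft_bsplit\<close> and
  \<open>bileveled_bsplit\<close>.\<close>

definition msym_act :: "(mtree \<times> pbt \<Rightarrow>\<^sub>0 rat) \<Rightarrow> msym" where
  "msym_act = lin_ext (\<lambda>(b, t).
    \<Sum>is\<in>restricted_leaf_multisets (underlying_tree b) (size t).
      basis_vec (Abs_mtree (bgraft (bsplit (Rep_mtree b) is) t)))"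

definition msym_coact :: "msym \<Rightarrow> (mtree \<times> pbt \<Rightarrow>\<^sub>0 rat)" where
  "msym_coact = lin_ext (\<lambda>b.
    \<Sum>is\<in>restricted_leaf_multisets (underlying_tree b) 1.
      basis_vec (Abs_mtree (bsplit (Rep_mtree b) is ! 0), fst (bsplit (Rep_mtree b) is ! 1)))"

end

theory Submission
  imports "HOL-Library.Tree" Defs
begin

hide_const (open) Tree.Leaf

text \<open>
  Both structures live inside one structure on binary trees whose nodes carry labels.  There the
  coproduct cuts a tree along the path from one leaf to the root, and the product with a tree whose
  root has label \<open>l\<close> and subtrees \<open>u\<close> and \<open>v\<close> satisfies the recursion
  \<open>x \<cdot> \<langle>u, l, v\<rangle> = \<Sum> \<langle>x' \<cdot> u, l, x'' \<cdot> v\<rangle>\<close>, the sum running over the splittings \<open>x \<rightarrow> (x', x'')\<close>: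
  of the leaves along which \<open>x\<close> is split, the one that ends up at the root of the grafted tree is
  chosen first.  With this recursion each of the main axioms follows from the one before.  Coassociativity
  (\<open>tsplit_coassoc\<close>) is an induction on the tree that is cut.  Multiplicativity of the coproduct
  (\<open>tsplit_tprod\<close>) is an induction on the right factor that uses coassociativity, and associativity
  (\<open>tprod_assoc\<close>) is an induction on the last factor that uses multiplicativity.

  A flag \<open>r\<close> makes the operations restricted: the splittings of the left factor whose first part is
  the empty tree are then dropped.  Restriction concerns only the first part, and an empty first part
  remains empty when it is split again, so the same three inductions prove the Hopf algebra axioms
  (\<open>r = False\<close>) and the Hopf module axioms (\<open>r = True\<close>) at once.

  A bi-leveled tree \<open>(t; T)\<close> becomes the tree \<open>t\<close> with nodes labelled by membership in \<open>T\<close>, and a plain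
  tree becomes the tree with all labels \<open>True\<close>.  These maps on basis elements are injective, and the
  operations to be studied are carried to the operations on labelled trees (\<open>tsplit_lab\<close>,
  \<open>tprod_lab\<close>); in the coaction the second tensor factor forgets the order ideal, which on labelled
  trees means setting all labels to \<open>True\<close>.  An identity may therefore be checked after this
  embedding.

  The antipode exists because every linear map that preserves the unit has a right inverse for
  convolution, computed by recursion on the number of nodes; applied twice, this shows that the right
  inverse of the identity is also a left inverse.
\<close>

section \<open>Linear extension\<close>

lemma lin_ext_superset:
  assumes "finite S" "Poly_Mapping.keys x \<subseteq> S"
  shows "lin_ext f x = (\<Sum>a\<in>S. scl (Poly_Mapping.lookup x a) (f a))"
  unfolding lin_ext_def using assms
  by (intro sum.mono_neutral_left) (auto simp: in_keys_iff)

lemma lin_ext_add: "lin_ext f (x + y) = lin_ext f x + lin_ext f y"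
proof -
  let ?S = "Poly_Mapping.keys x \<union> Poly_Mapping.keys y"
  have "Poly_Mapping.keys (x + y) \<subseteq> ?S" by (rule Poly_Mapping.keys_add)
  then show ?thesis
    by (simp add: lin_ext_superset [where S = ?S] lookup_add scl.scale_left_distrib sum.distrib)
qed

lemma lin_ext_scl: "lin_ext f (scl c x) = scl c (lin_ext f x)"
proof -
  have "Poly_Mapping.keys (scl c x) \<subseteq> Poly_Mapping.keys x" by (auto simp: in_keys_iff)
  then show ?thesis
    by (simp add: lin_ext_superset [where S = "Poly_Mapping.keys x"] scl.scale_sum_right)
qed

lemma linear_lin_ext: "linear_map (lin_ext f)"
  by unfold_locales (simp_all add: lin_ext_add lin_ext_scl)

lemma lin_ext_zero [simp]: "lin_ext f 0 = 0"
  by (simp add: lin_ext_def)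

lemma lin_ext_sum: "lin_ext f (\<Sum>i\<in>I. g i) = (\<Sum>i\<in>I. lin_ext f (g i))"
  by (induction I rule: infinite_finite_induct) (simp_all add: lin_ext_add)

text \<open>Identities between linear expressions need only be checked on basis vectors.\<close>

lemma basis_induct [case_names add scl basis]:
  assumes add: "\<And>x y. P x \<Longrightarrow> P y \<Longrightarrow> P (x + y)"
    and scl: "\<And>c x. P x \<Longrightarrow> P (scl c x)"
    and basis: "\<And>a. P (basis_vec a)"
  shows "P x"
proof -
  have "P (scl 0 (basis_vec undefined))" by (intro scl basis)
  then have zero: "P 0" by simp
  have "P (\<Sum>a\<in>S. scl (Poly_Mapping.lookup x a) (basis_vec a))" if "finite S" for S
    using that by induction (simp_all add: zero add scl basis)
  moreover have "(\<Sum>a\<in>Poly_Mapping.keys x. scl (Poly_Mapping.lookup x a) (basis_vec a)) = x"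
    by (rule poly_mapping_eqI)
      (auto simp: lookup_sum lookup_single when_def in_keys_iff if_distrib cong: if_cong)
  ultimately show ?thesis by (metis finite_keys)
qed

lemma linear_map_scl: "linear_map f \<Longrightarrow> f (scl c x) = scl c (f x)"
  by (simp add: Vector_Spaces.linear_iff)

lemma linear_lin_ext_comp:
  assumes "linear_map f"
  shows "f (lin_ext g x) = lin_ext (\<lambda>a. f (g a)) x"
proof -
  interpret f: Vector_Spaces.linear scl scl f by (rule assms)
  show ?thesis
    by (induction x rule: basis_induct) (simp_all add: lin_ext_add lin_ext_scl f.add f.scale)
qed

text \<open>
  \<open>lin_ext\<close> is the bind operation of a commutative monad with unit \<open>basis_vec\<close>: the next lemma is
  associativity of the monad, \<open>lin_ext_swap\<close> its commutativity.  Nested sums over splittings are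
  written as nested \<open>lin_ext\<close> and rearranged by these two laws.
\<close>

lemma lin_ext_lin_ext: "lin_ext f (lin_ext g x) = lin_ext (\<lambda>a. lin_ext f (g a)) x"
  by (induction x rule: basis_induct) (simp_all add: lin_ext_add lin_ext_scl)

lemma lin_ext_add_fun: "lin_ext (\<lambda>a. f a + g a) x = lin_ext f x + lin_ext g x"
  by (induction x rule: basis_induct)
    (simp_all add: lin_ext_add lin_ext_scl scl.scale_right_distrib add_ac)

lemma lin_ext_scl_fun: "lin_ext (\<lambda>a. scl c (f a)) x = scl c (lin_ext f x)"
  by (induction x rule: basis_induct)
    (simp_all add: lin_ext_add lin_ext_scl scl.scale_right_distrib mult.commute)

lemma lin_ext_swap:
  "lin_ext (\<lambda>a. lin_ext (\<lambda>b. f a b) y) x = lin_ext (\<lambda>b. lin_ext (\<lambda>a. f a b) x) y"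
  by (induction x rule: basis_induct)
    (simp_all add: lin_ext_add lin_ext_scl lin_ext_add_fun lin_ext_scl_fun)

lemma lin_ext_rotate:
  "lin_ext (\<lambda>c. lin_ext (\<lambda>a. lin_ext (\<lambda>b. f a b c) y) x) z =
    lin_ext (\<lambda>a. lin_ext (\<lambda>b. lin_ext (\<lambda>c. f a b c) z) y) x"
  by (subst lin_ext_swap) (simp only: lin_ext_swap [of _ y z])

lemma lin_ext_id [simp]: "lin_ext basis_vec x = x"
  by (induction x rule: basis_induct) (simp_all add: lin_ext_add lin_ext_scl)

lemma lin_ext_zero_fun [simp]: "lin_ext (\<lambda>a. 0) x = 0"
  by (simp add: lin_ext_def)

lemma tensor_add_left: "(x + y) \<otimes> z = x \<otimes> z + y \<otimes> z"
  by (simp add: tensor_def lin_ext_add)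

lemma tensor_add_right: "x \<otimes> (y + z) = x \<otimes> y + x \<otimes> z"
  by (simp add: tensor_def lin_ext_add lin_ext_add_fun)

lemma tensor_scl_left: "scl c x \<otimes> y = scl c (x \<otimes> y)"
  by (simp add: tensor_def lin_ext_scl)

lemma tensor_scl_right: "x \<otimes> scl c y = scl c (x \<otimes> y)"
  by (simp add: tensor_def lin_ext_scl lin_ext_scl_fun)

lemmas multilinear =
  lin_ext_add lin_ext_scl tensor_add_left tensor_add_right tensor_scl_left tensor_scl_right

lemma lin_ext_tensor:
  "lin_ext f (x \<otimes> y) = lin_ext (\<lambda>a. lin_ext (\<lambda>b. f (a, b)) y) x"
  by (simp add: tensor_def lin_ext_lin_ext)

lemma lin_ext_tensor_left: "lin_ext f x \<otimes> y = lin_ext (\<lambda>a. f a \<otimes> y) x"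
  by (induction x rule: basis_induct) (simp_all add: multilinear)

lemma lin_ext_tensor_right: "x \<otimes> lin_ext f y = lin_ext (\<lambda>a. x \<otimes> f a) y"
  by (induction y rule: basis_induct) (simp_all add: multilinear)

text \<open>The linear map induced by a map of bases.\<close>

definition push :: "('a \<Rightarrow> 'b) \<Rightarrow> ('a \<Rightarrow>\<^sub>0 'k::field) \<Rightarrow> ('b \<Rightarrow>\<^sub>0 'k)" where
  "push j = lin_ext (\<lambda>a. basis_vec (j a))"

lemma push_basis_vec [simp]: "push j (basis_vec a) = basis_vec (j a)"
  by (simp add: push_def)

lemma lin_ext_push: "lin_ext f (push j x) = lin_ext (\<lambda>a. f (j a)) x"
  by (simp add: push_def lin_ext_lin_ext)

lemma push_lin_ext: "push j (lin_ext f x) = lin_ext (\<lambda>a. push j (f a)) x"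
  by (simp add: push_def lin_ext_lin_ext)

lemma push_linear: "push j (x + y) = push j x + push j y" "push j (scl c x) = scl c (push j x)"
  by (simp_all add: push_def lin_ext_add lin_ext_scl)

lemma push_sum: "push j (\<Sum>i\<in>I. g i) = (\<Sum>i\<in>I. push j (g i))"
  by (simp add: push_def lin_ext_sum)

lemma push_tensor: "push (map_prod i j) (x \<otimes> y) = push i x \<otimes> push j y"
  by (simp add: push_def lin_ext_tensor tensor_def lin_ext_lin_ext)

lemma inj_push:
  assumes "inj j"
  shows "inj (push j)"
proof (rule inj_on_inverseI)
  fix x
  show "push (inv j) (push j x) = x"
    using assms by (simp add: push_def lin_ext_lin_ext)
qed


section \<open>Cutting and multiplying labelled trees\<close>

text \<open>
  The sum of all splittings of a tree along one leaf; for \<open>r = True\<close> only of those with nonempty first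
  part.  If the leaf lies in the right subtree, the first part contains the root, so that the
  recursive call there is never restricted.
\<close>

fun tsplit :: "bool \<Rightarrow> 'c tree \<Rightarrow> ('c tree \<times> 'c tree \<Rightarrow>\<^sub>0 'k::field)" where
  "tsplit r \<langle>\<rangle> = (if r then 0 else basis_vec (\<langle>\<rangle>, \<langle>\<rangle>))"
| "tsplit r \<langle>a, l, c\<rangle> =
    lin_ext (\<lambda>p. basis_vec (fst p, \<langle>snd p, l, c\<rangle>)) (tsplit r a) +
    lin_ext (\<lambda>p. basis_vec (\<langle>a, l, fst p\<rangle>, snd p)) (tsplit False c)"

text \<open>
  In the recursion the left factor is first split at the leaf that separates what is grafted onto
  \<open>u\<close> from what is grafted onto \<open>v\<close>.  For \<open>r = True\<close> this is the restricted action, except that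
  the empty tree, which has no restricted splitting, is still fixed by the empty tree.  With this
  convention \<open>tsplit_tprod\<close> and \<open>tprod_assoc\<close> hold for all trees.
\<close>

fun tprod :: "bool \<Rightarrow> 'c tree \<Rightarrow> 'c tree \<Rightarrow> ('c tree \<Rightarrow>\<^sub>0 'k::field)" where
  "tprod r t \<langle>\<rangle> = basis_vec t"
| "tprod r t \<langle>u, l, v\<rangle> = lin_ext (\<lambda>p.
     lin_ext (\<lambda>x. lin_ext (\<lambda>y. basis_vec \<langle>x, l, y\<rangle>) (tprod False (snd p) v)) (tprod r (fst p) u))
     (tsplit r t)"

lemma lin_ext_tsplit_Node:
  "lin_ext f (tsplit r \<langle>a, l, c\<rangle>) =
    lin_ext (\<lambda>p. f (fst p, \<langle>snd p, l, c\<rangle>)) (tsplit r a) +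
    lin_ext (\<lambda>p. f (\<langle>a, l, fst p\<rangle>, snd p)) (tsplit False c)"
  by (simp add: lin_ext_add lin_ext_lin_ext)

text \<open>
  Both sides sum over all ways to cut \<open>t\<close> along two leaves.  For a tree with root the two leaves are
  both in the left subtree, one in each subtree, or both in the right subtree; the mixed terms agree
  because the two cuts are independent.  Restricted cuts occur only where the first part is involved.
\<close>

lemma tsplit_coassoc:
  "lin_ext (\<lambda>p. lin_ext (\<lambda>q. f (fst q) (snd q) (snd p)) (tsplit r (fst p))) (tsplit r t) =
   lin_ext (\<lambda>p. lin_ext (\<lambda>q. f (fst p) (fst q) (snd q)) (tsplit False (snd p))) (tsplit r t)"
proof (induction t arbitrary: r f)
  case Leaf
  then show ?case by simp
next
  case (Node a l c)
  show ?case
    by (simp del: tsplit.simps(2) add: lin_ext_tsplit_Node lin_ext_add_fun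
        Node.IH(1) [of "\<lambda>x y z. f x y \<langle>z, l, c\<rangle>"]
        Node.IH(2) [of "\<lambda>x y z. f \<langle>a, l, x\<rangle> y z"]
        lin_ext_swap [of _ "tsplit r a" "tsplit False c"] add.assoc)
qed

lemma lin_ext_tprod_Node:
  "lin_ext f (tprod r t \<langle>u, l, v\<rangle>) = lin_ext (\<lambda>p.
     lin_ext (\<lambda>x. lin_ext (\<lambda>y. f \<langle>x, l, y\<rangle>) (tprod False (snd p) v)) (tprod r (fst p) u))
     (tsplit r t)"
  by (simp add: lin_ext_lin_ext)

text \<open>
  Splitting \<open>x \<cdot> \<langle>u, l, v\<rangle>\<close>, a sum of trees \<open>\<langle>x' \<cdot> u, l, x'' \<cdot> v\<rangle>\<close>, means splitting either \<open>x' \<cdot> u\<close> or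
  \<open>x'' \<cdot> v\<close>, to which the induction hypothesis applies.  In both cases \<open>x\<close> ends up cut into three
  parts, and coassociativity turns the order of the cuts into the one found on the right hand side.
\<close>

lemma tsplit_tprod:
  fixes x y :: "'c tree"
  shows "lin_ext (tsplit r) (tprod r x y) = (lin_ext (\<lambda>p. lin_ext (\<lambda>q.
      tprod r (fst p) (fst q) \<otimes> tprod False (snd p) (snd q)) (tsplit False y)) (tsplit r x)
      :: 'c tree \<times> 'c tree \<Rightarrow>\<^sub>0 'k::field)"
proof (induction y arbitrary: r x)
  case Leaf
  then show ?case by simp
next
  case (Node u l v)
  let ?P = "\<lambda>x. tprod False x v :: 'c tree \<Rightarrow>\<^sub>0 'k"
  have first: "lin_ext (\<lambda>w. lin_ext g (tsplit r w)) (tprod r z u) =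
      lin_ext (\<lambda>p. lin_ext (\<lambda>q. lin_ext g (tprod r (fst p) (fst q) \<otimes> tprod False (snd p) (snd q)))
        (tsplit False u)) (tsplit r z)"
    for z and g :: "_ \<Rightarrow> ('c tree \<times> 'c tree \<Rightarrow>\<^sub>0 'k)"
    using arg_cong [OF Node.IH(1) [of r z], of "lin_ext g"] by (simp add: lin_ext_lin_ext)
  have second: "lin_ext (\<lambda>w. lin_ext g (tsplit False w)) (tprod False z v) =
      lin_ext (\<lambda>p. lin_ext (\<lambda>q. lin_ext g (tprod False (fst p) (fst q) \<otimes> tprod False (snd p) (snd q)))
        (tsplit False v)) (tsplit False z)"
    for z and g :: "_ \<Rightarrow> ('c tree \<times> 'c tree \<Rightarrow>\<^sub>0 'k)"
    using arg_cong [OF Node.IH(2) [of False z], of "lin_ext g"] by (simp add: lin_ext_lin_ext)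
  \<comment> \<open>the contribution of a splitting of \<open>x\<close> into three parts \<open>a, b, c\<close>: in \<open>K\<close> the tree is then cut
    inside \<open>u\<close>, in \<open>L\<close> inside \<open>v\<close>\<close>
  define K :: "'c tree \<Rightarrow> 'c tree \<Rightarrow> 'c tree \<Rightarrow> ('c tree \<times> 'c tree \<Rightarrow>\<^sub>0 'k)"
    where "K a b c = lin_ext (\<lambda>q. tprod r a (fst q) \<otimes>
      lin_ext (\<lambda>x. lin_ext (\<lambda>y. basis_vec \<langle>x, l, y\<rangle>) (?P c)) (tprod False b (snd q)))
      (tsplit False u)" for a b c
  have K: "K a b c = lin_ext (\<lambda>q. lin_ext (\<lambda>y. lin_ext (\<lambda>s. basis_vec (fst s, \<langle>snd s, l, y\<rangle>))
      (tprod r a (fst q) \<otimes> tprod False b (snd q))) (?P c)) (tsplit False u)" for a b c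
    by (simp add: K_def tensor_def lin_ext_lin_ext) (subst lin_ext_rotate, rule refl)
  define L :: "'c tree \<Rightarrow> 'c tree \<Rightarrow> 'c tree \<Rightarrow> ('c tree \<times> 'c tree \<Rightarrow>\<^sub>0 'k)"
    where "L a b c = lin_ext (\<lambda>q.
      lin_ext (\<lambda>x. lin_ext (\<lambda>y. basis_vec \<langle>x, l, y\<rangle>) (tprod False b (fst q))) (tprod r a u) \<otimes>
      tprod False c (snd q)) (tsplit False v)" for a b c
  have L: "L a b c = lin_ext (\<lambda>q. lin_ext (\<lambda>x. lin_ext (\<lambda>s. basis_vec (\<langle>x, l, fst s\<rangle>, snd s))
      (tprod False b (fst q) \<otimes> tprod False c (snd q))) (tprod r a u)) (tsplit False v)" for a b c
    by (simp add: L_def tensor_def lin_ext_lin_ext)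
  let ?left = "lin_ext (\<lambda>p. lin_ext (\<lambda>y. lin_ext (\<lambda>w. lin_ext (\<lambda>q. basis_vec (fst q, \<langle>snd q, l, y\<rangle>))
        (tsplit r w)) (tprod r (fst p) u)) (?P (snd p))) (tsplit r x)"
  let ?right = "lin_ext (\<lambda>p. lin_ext (\<lambda>w. lin_ext (\<lambda>y. lin_ext (\<lambda>q. basis_vec (\<langle>w, l, fst q\<rangle>, snd q))
        (tsplit False y)) (?P (snd p))) (tprod r (fst p) u)) (tsplit r x)"
  have "lin_ext (tsplit r) (tprod r x \<langle>u, l, v\<rangle>) = ?left + ?right"
    unfolding lin_ext_tprod_Node
    by (simp add: lin_ext_add_fun) (subst lin_ext_swap, rule refl)
  moreover have "?left = lin_ext (\<lambda>p. lin_ext (\<lambda>q.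
      tprod r (fst p) (fst q) \<otimes> tprod False (snd p) \<langle>snd q, l, v\<rangle>) (tsplit False u)) (tsplit r x)"
  proof -
    have "?left = lin_ext (\<lambda>p. lin_ext (\<lambda>p'. K (fst p') (snd p') (snd p)) (tsplit r (fst p))) (tsplit r x)"
      unfolding first K
      by (subst (2) lin_ext_swap, subst (3) lin_ext_swap) (rule refl)
    also have "\<dots> = lin_ext (\<lambda>p. lin_ext (\<lambda>p'. K (fst p) (fst p') (snd p')) (tsplit False (snd p))) (tsplit r x)"
      by (rule tsplit_coassoc)
    also have "\<dots> = lin_ext (\<lambda>p. lin_ext (\<lambda>q.
      tprod r (fst p) (fst q) \<otimes> tprod False (snd p) \<langle>snd q, l, v\<rangle>) (tsplit False u)) (tsplit r x)"
      unfolding K_def by (subst (2) lin_ext_swap) (simp add: lin_ext_tensor_right)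
    finally show ?thesis .
  qed
  moreover have "?right = lin_ext (\<lambda>p. lin_ext (\<lambda>q.
      tprod r (fst p) \<langle>u, l, fst q\<rangle> \<otimes> tprod False (snd p) (snd q)) (tsplit False v)) (tsplit r x)"
  proof -
    have "?right = lin_ext (\<lambda>p. lin_ext (\<lambda>p'. L (fst p) (fst p') (snd p')) (tsplit False (snd p))) (tsplit r x)"
      unfolding second L
      by (subst (2) lin_ext_swap, subst (3) lin_ext_swap) (rule refl)
    also have "\<dots> = lin_ext (\<lambda>p. lin_ext (\<lambda>p'. L (fst p') (snd p') (snd p)) (tsplit r (fst p))) (tsplit r x)"
      by (rule tsplit_coassoc [symmetric])
    also have "\<dots> = lin_ext (\<lambda>p. lin_ext (\<lambda>q.
      tprod r (fst p) \<langle>u, l, fst q\<rangle> \<otimes> tprod False (snd p) (snd q)) (tsplit False v)) (tsplit r x)"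
      unfolding L_def by (subst (2) lin_ext_swap) (simp add: lin_ext_tensor_left)
    finally show ?thesis .
  qed
  ultimately show ?case
    by (simp del: tsplit.simps(2) tprod.simps(2) add: lin_ext_tsplit_Node lin_ext_add_fun)
qed


text \<open>
  For \<open>z = \<langle>u, l, v\<rangle>\<close> both sides are sums of trees with root labelled \<open>l\<close>.  On the left \<open>x \<cdot> y\<close> is split,
  which by \<open>tsplit_tprod\<close> amounts to splitting \<open>x\<close> and \<open>y\<close> separately; the induction hypothesis is then
  applied in both subtrees.
\<close>

lemma tprod_assoc:
  fixes x y z :: "'c tree"
  shows "lin_ext (\<lambda>w. tprod r w z) (tprod r x y) =
    (lin_ext (tprod r x) (tprod False y z) :: 'c tree \<Rightarrow>\<^sub>0 'k::field)"
proof (induction z arbitrary: r x y)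
  case Leaf
  then show ?case by simp
next
  case (Node u l v)
  define N :: "('c tree \<Rightarrow>\<^sub>0 'k) \<Rightarrow> ('c tree \<Rightarrow>\<^sub>0 'k) \<Rightarrow> ('c tree \<Rightarrow>\<^sub>0 'k)"
    where "N x y = lin_ext (\<lambda>s. basis_vec \<langle>fst s, l, snd s\<rangle>) (x \<otimes> y)" for x y
  have N_left: "N (lin_ext f x) y = lin_ext (\<lambda>a. N (f a) y) x"
    and N_right: "N x (lin_ext f y) = lin_ext (\<lambda>a. N x (f a)) y"
    for f :: "'c tree \<Rightarrow> ('c tree \<Rightarrow>\<^sub>0 'k)" and x y
    by (simp_all add: N_def lin_ext_tensor_left lin_ext_tensor_right lin_ext_lin_ext)
  have tprod_N: "tprod r t \<langle>u, l, v\<rangle> = lin_ext (\<lambda>p. N (tprod r (fst p) u) (tprod False (snd p) v)) (tsplit r t)"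
    for r t u v by (simp add: N_def lin_ext_tensor)
  have "lin_ext (\<lambda>w. tprod r w \<langle>u, l, v\<rangle>) (tprod r x y) =
      lin_ext (\<lambda>p. N (tprod r (fst p) u) (tprod False (snd p) v)) (lin_ext (tsplit r) (tprod r x y))"
    unfolding tprod_N by (simp add: lin_ext_lin_ext)
  also have "\<dots> = lin_ext (\<lambda>p. lin_ext (\<lambda>q.
      N (lin_ext (\<lambda>w. tprod r w u) (tprod r (fst p) (fst q)))
        (lin_ext (\<lambda>w. tprod False w v) (tprod False (snd p) (snd q)))) (tsplit False y)) (tsplit r x)"
    unfolding tsplit_tprod N_left unfolding N_right by (simp add: lin_ext_lin_ext lin_ext_tensor)
  also have "\<dots> = lin_ext (\<lambda>p. lin_ext (\<lambda>q.
      N (lin_ext (tprod r (fst p)) (tprod False (fst q) u))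
        (lin_ext (tprod False (snd p)) (tprod False (snd q) v))) (tsplit False y)) (tsplit r x)"
    unfolding Node.IH ..
  also have "\<dots> = lin_ext (tprod r x) (tprod False y \<langle>u, l, v\<rangle>)"
  proof -
    have "lin_ext (tprod r x) (N a b) = lin_ext (\<lambda>p.
        N (lin_ext (tprod r (fst p)) a) (lin_ext (tprod False (snd p)) b)) (tsplit r x)" for a b
    proof -
      have "lin_ext (tprod r x) (N a b) = lin_ext (\<lambda>c. lin_ext (\<lambda>d. tprod r x \<langle>c, l, d\<rangle>) b) a"
        by (simp add: N_def lin_ext_lin_ext lin_ext_tensor del: tprod.simps)
      also have "\<dots> = lin_ext (\<lambda>p. lin_ext (\<lambda>c. lin_ext (\<lambda>d.
          N (tprod r (fst p) c) (tprod False (snd p) d)) b) a) (tsplit r x)"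
        unfolding tprod_N by (rule lin_ext_rotate [symmetric])
      finally show ?thesis
        unfolding N_left unfolding N_right .
    qed
    then show ?thesis
      unfolding tprod_N [of False y] by (simp add: lin_ext_lin_ext) (rule lin_ext_swap)
  qed
  finally show ?case .
qed

text \<open>
  Only the splitting along the last leaf has an empty second part, and only the one along the first
  leaf has an empty first part.
\<close>

lemma tsplit_counit_right:
  fixes t :: "'c tree"
  assumes "r \<longrightarrow> t \<noteq> \<langle>\<rangle>"
  shows "lin_ext (\<lambda>p. if snd p = \<langle>\<rangle> then basis_vec (fst p) else 0) (tsplit r t) =
    (basis_vec t :: 'c tree \<Rightarrow>\<^sub>0 'k::field)" (is "lin_ext ?f _ = _")
  using assms
proof (induction t arbitrary: r)
  case (Node a l c)
  have "lin_ext (\<lambda>p. if snd p = \<langle>\<rangle> then basis_vec \<langle>a, l, fst p\<rangle> else 0) (tsplit False c) =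
     push (\<lambda>x. \<langle>a, l, x\<rangle>) (lin_ext ?f (tsplit False c))"
    by (simp add: push_def lin_ext_lin_ext if_distrib cong: if_cong)
  then show ?case by (simp add: lin_ext_tsplit_Node Node.IH del: tsplit.simps(2) cong: if_cong)
qed simp

lemma tsplit_counit_left:
  fixes t :: "'c tree"
  shows "lin_ext (\<lambda>p. if fst p = \<langle>\<rangle> then basis_vec (snd p) else 0) (tsplit False t) =
    (basis_vec t :: 'c tree \<Rightarrow>\<^sub>0 'k::field)" (is "lin_ext ?f _ = _")
proof (induction t)
  case (Node a l c)
  have "lin_ext (\<lambda>p. if fst p = \<langle>\<rangle> then basis_vec \<langle>snd p, l, c\<rangle> else 0) (tsplit False a) =
     push (\<lambda>x. \<langle>x, l, c\<rangle>) (lin_ext ?f (tsplit False a))"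
    by (simp add: push_def lin_ext_lin_ext if_distrib cong: if_cong)
  then show ?case by (simp add: lin_ext_tsplit_Node Node.IH del: tsplit.simps(2) cong: if_cong)
qed simp

lemma tprod_Leaf_left: "tprod False \<langle>\<rangle> = basis_vec"
proof
  show "tprod False \<langle>\<rangle> y = basis_vec y" for y :: "'c tree" by (induction y) simp_all
qed

text \<open>Splitting and multiplying do not look at the labels.\<close>

lemma tsplit_map_tree: "tsplit r (map_tree g t) = push (map_prod (map_tree g) (map_tree g)) (tsplit r t)"
  by (induction t arbitrary: r) (simp_all add: push_def lin_ext_lin_ext lin_ext_add)

lemma tprod_map_tree: "tprod r (map_tree g t) (map_tree g s) = push (map_tree g) (tprod r t s)"
  by (induction s arbitrary: r t) (simp_all add: tsplit_map_tree push_def lin_ext_lin_ext)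


section \<open>Trees with a distinguished set of nodes as labelled trees\<close>

text \<open>
  Only \<open>T \<inter> {1..size t}\<close> enters into \<open>lab t T\<close>.  Hence the parts of a splitting need no truncation
  of the set, and \<open>UNIV\<close> labels every node \<open>True\<close>.
\<close>

fun lab :: "pbt \<Rightarrow> nat set \<Rightarrow> bool tree" where
  "lab Leaf T = \<langle>\<rangle>"
| "lab (Vee l r) T = \<langle>lab l T, size l + 1 \<in> T, lab r {i. i + (size l + 1) \<in> T}\<rangle>"

abbreviation full :: "pbt \<Rightarrow> bool tree" where
  "full t \<equiv> lab t UNIV"

lemma lab_cong: "(\<And>i. i \<in> {1..size t} \<Longrightarrow> i \<in> T \<longleftrightarrow> i \<in> T') \<Longrightarrow> lab t T = lab t T'"
proof (induction t arbitrary: T T')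
  case (Vee l r)
  have "lab l T = lab l T'" by (rule Vee.IH) (simp add: Vee.prems)
  moreover have "lab r {i. i + (size l + 1) \<in> T} = lab r {i. i + (size l + 1) \<in> T'}"
    by (rule Vee.IH) (use Vee.prems in auto)
  moreover have "size l + 1 \<in> T \<longleftrightarrow> size l + 1 \<in> T'" using Vee.prems by auto
  ultimately show ?case by simp
qed simp

lemma lab_eq_Leaf [simp]: "lab t T = \<langle>\<rangle> \<longleftrightarrow> t = Leaf"
  by (cases t) auto

lemma lab_inject:
  "lab t T = lab t' T' \<Longrightarrow> t = t' \<and> T \<inter> {1..size t} = T' \<inter> {1..size t}"
proof (induction t arbitrary: t' T T')
  case Leaf
  then show ?case by (cases t') auto
next
  case (Vee l r)
  then have "t' \<noteq> Leaf" by auto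
  then obtain l' r' where t': "t' = Vee l' r'" by (cases t') blast+
  have eqs: "lab l T = lab l' T'" "(size l + 1 \<in> T) = (size l' + 1 \<in> T')"
    "lab r {i. i + (size l + 1) \<in> T} = lab r' {i. i + (size l' + 1) \<in> T'}"
    using Vee.prems unfolding t' lab.simps tree.inject by blast+
  note l = Vee.IH(1) [OF eqs(1)]
  note r = Vee.IH(2) [OF eqs(3)]
  have "i \<in> T \<longleftrightarrow> i \<in> T'" if i: "i \<in> {1..size (Vee l r)}" for i
  proof -
    consider "i \<le> size l" | "i = size l + 1" | "i > size l + 1" by linarith
    then show ?thesis
    proof cases
      case 1
      with i have "i \<in> {1..size l}" by simp
      with l show ?thesis by blast
    next
      case 2
      with eqs(2) conjunct1 [OF l] show ?thesis by simp
    next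
      case 3
      then obtain k where k: "k \<in> {1..size r}" "i = k + (size l + 1)"
        using i by (intro that [of "i - (size l + 1)"]) auto
      then have "k \<in> {i. i + (size l + 1) \<in> T} \<longleftrightarrow> k \<in> {i. i + (size l' + 1) \<in> T'}"
        using r by blast
      then show ?thesis using k(2) conjunct1 [OF l] by simp
    qed
  qed
  with l r t' show ?case by blast
qed

lemma map_tree_lab [simp]: "map_tree (\<lambda>_. True) (lab t T) = full t"
  by (induction t arbitrary: T) simp_all

lemma size_split_leaf_fst [simp]: "i \<le> size t \<Longrightarrow> size (fst (split_leaf t i)) = i"
  and size_split_leaf_snd [simp]: "i \<le> size t \<Longrightarrow> size (snd (split_leaf t i)) = size t - i"
  by (metis size_split_leaf prod.collapse)+

text \<open>
  The lower bound \<open>of_bool r\<close> expresses restriction: the first part of the splitting along leaf \<open>i\<close>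
  has \<open>i\<close> nodes, so it is empty exactly for \<open>i = 0\<close>.
\<close>

lemma tsplit_lab:
  "tsplit r (lab t T) = (\<Sum>i\<in>{of_bool r..size t}.
    basis_vec (lab (fst (split_leaf t i)) T, lab (snd (split_leaf t i)) {j. j + i \<in> T}) ::
    bool tree \<times> bool tree \<Rightarrow>\<^sub>0 'k::field)"
proof (induction t arbitrary: r T)
  case Leaf
  then show ?case by (cases r) auto
next
  case (Vee a c)
  let ?f = "\<lambda>i. (lab (fst (split_leaf (Vee a c) i)) T, lab (snd (split_leaf (Vee a c) i)) {j. j + i \<in> T})"
  have first: "?f i = (lab (fst (split_leaf a i)) T,
      \<langle>lab (snd (split_leaf a i)) {j. j + i \<in> T}, size a + 1 \<in> T, lab c {j. j + (size a + 1) \<in> T}\<rangle>)"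
    if "i \<le> size a" for i
    using that by (simp add: split_beta add.assoc size_split_leaf_snd)
  have second: "?f (i + (size a + 1)) = 
      (\<langle>lab a T, size a + 1 \<in> T, lab (fst (split_leaf c i)) {j. j + (size a + 1) \<in> T}\<rangle>,
       lab (snd (split_leaf c i)) {j. j + i \<in> {j. j + (size a + 1) \<in> T}})" for i
    by (simp add: split_beta add.assoc)
  have I: "{of_bool r..size (Vee a c)} = {of_bool r..size a} \<union> (\<lambda>i. i + (size a + 1)) ` {0..size c}"
    unfolding image_add_atLeastAtMost' by (cases r) auto
  have "(\<Sum>i\<in>{of_bool r..size (Vee a c)}. basis_vec (?f i) :: bool tree \<times> bool tree \<Rightarrow>\<^sub>0 'k) =
      (\<Sum>i\<in>{of_bool r..size a}. basis_vec (?f i)) +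
      (\<Sum>i\<in>{0..size c}. basis_vec (?f (i + (size a + 1))))"
    unfolding I by (subst sum.union_disjoint) (auto simp: sum.reindex inj_on_def)
  also have "(\<Sum>i\<in>{of_bool r..size a}. basis_vec (?f i) :: bool tree \<times> bool tree \<Rightarrow>\<^sub>0 'k) = lin_ext (\<lambda>p. basis_vec
      (fst p, \<langle>snd p, size a + 1 \<in> T, lab c {j. j + (size a + 1) \<in> T}\<rangle>)) (tsplit r (lab a T))"
    unfolding Vee.IH lin_ext_sum lin_ext_basis_vec fst_conv snd_conv
    by (rule sum.cong [OF refl], subst first) simp_all
  also have "(\<Sum>i\<in>{0..size c}. basis_vec (?f (i + (size a + 1))) :: bool tree \<times> bool tree \<Rightarrow>\<^sub>0 'k) = lin_ext (\<lambda>p. basis_vec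
      (\<langle>lab a T, size a + 1 \<in> T, fst p\<rangle>, snd p)) (tsplit False (lab c {j. j + (size a + 1) \<in> T}))"
    unfolding Vee.IH lin_ext_sum lin_ext_basis_vec fst_conv snd_conv second by simp
  finally show ?case by simp
qed


section \<open>Splitting along a multiset of leaves\<close>

text \<open>Splitting along \<open>j\<close> and then along \<open>i \<le> j\<close> gives the same three parts as the other order.\<close>

lemma split_leaf_split_leaf:
  assumes "i \<le> j" "j \<le> size t"
  shows "split_leaf (fst (split_leaf t j)) i =
      (fst (split_leaf t i), fst (split_leaf (snd (split_leaf t i)) (j - i)))"
    and "snd (split_leaf t j) = snd (split_leaf (snd (split_leaf t i)) (j - i))"
proof -
  have "split_leaf (fst (split_leaf t j)) i =
      (fst (split_leaf t i), fst (split_leaf (snd (split_leaf t i)) (j - i))) \<and>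
    snd (split_leaf t j) = snd (split_leaf (snd (split_leaf t i)) (j - i))"
    using assms
  proof (induction t arbitrary: i j)
    case (Vee a c)
    consider "j \<le> size a" | "i \<le> size a" "size a < j" | "size a < i" by linarith
    then show ?case
    proof cases
      case 1
      then show ?thesis using Vee.IH(1) [of i j] Vee.prems by (simp add: split_beta diff_le_mono)
    next
      case 2
      then have "\<not> j - i \<le> size a - i" by linarith
      with 2 show ?thesis using Vee.prems by (simp add: split_beta)
    next
      case 3
      then show ?thesis using Vee.IH(2) [of "i - size a - 1" "j - size a - 1"] Vee.prems
        by (simp add: split_beta)
    qed
  qed simp
  then show "split_leaf (fst (split_leaf t j)) i =
      (fst (split_leaf t i), fst (split_leaf (snd (split_leaf t i)) (j - i)))"
    and "snd (split_leaf t j) = snd (split_leaf (snd (split_leaf t i)) (j - i))" by auto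
qed

text \<open>
  A multiset of leaves may be cut at any of its members \<open>i\<close>: the members before it split the first part
  of the splitting along \<open>i\<close>, those after it the second part, in which leaf numbers are lowered by \<open>i\<close>.
\<close>

lemma split_leaves_append:
  assumes "sorted is" "set is \<subseteq> {..i}" "i \<le> size t"
  shows "split_leaves t (is @ i # map (\<lambda>j. j + i) js) =
    split_leaves (fst (split_leaf t i)) is @ split_leaves (snd (split_leaf t i)) js"
  using assms
proof (induction t "is" arbitrary: i rule: split_leaves.induct)
  case (1 t)
  then show ?case by (simp add: split_beta comp_def)
next
  case (2 t k "is")
  have k: "k \<le> i" using 2 by auto
  let ?u = "snd (split_leaf t k)"
  have map: "map ((\<lambda>j. j - k) \<circ> (\<lambda>j. j + i)) js = map (\<lambda>j. j + (i - k)) js"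
    using k by simp
  have "split_leaves ?u (map (\<lambda>j. j - k) is @ (i - k) # map (\<lambda>j. j + (i - k)) js) =
      split_leaves (fst (split_leaf ?u (i - k))) (map (\<lambda>j. j - k) is) @
      split_leaves (snd (split_leaf ?u (i - k))) js"
  proof (rule 2(1) [OF prod.collapse refl])
    show "sorted (map (\<lambda>j. j - k) is)"
      using 2(2) by (auto simp: sorted_iff_nth_mono intro: diff_le_mono)
    show "set (map (\<lambda>j. j - k) is) \<subseteq> {..i - k}" using 2(3) by auto
    show "i - k \<le> size ?u" using 2(4) k by simp
  qed
  then show ?case
    using split_leaf_split_leaf [OF k 2(4)] by (simp add: split_beta map)
qed

lemma bsplit_append:
  assumes "sorted is" "set is \<subseteq> {..i}" "i \<le> size t"
  shows "bsplit (t, T) (is @ i # map (\<lambda>j. j + i) js) =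
    bsplit (fst (split_leaf t i), T) is @ bsplit (snd (split_leaf t i), {j. j + i \<in> T}) js"
proof -
  have "0 # is @ i # map (\<lambda>j. j + i) js = (0 # is) @ map (\<lambda>j. j + i) (0 # js)" by simp
  then show ?thesis
    unfolding bsplit_def prod.case split_leaves_append [OF assms]
    by (simp only:) (simp add: zip_map2 split_beta comp_def add.assoc
        del: list.map append_Cons)
qed

text \<open>The leaf multisets of the ordinary and of the restricted operations under one name.\<close>

definition admissible :: "bool \<Rightarrow> pbt \<Rightarrow> nat \<Rightarrow> nat list set" where
  "admissible r t m = {is \<in> leaf_multisets t m. r \<longrightarrow> split_leaves t is ! 0 \<noteq> Leaf}"

lemma admissible_False: "admissible False t m = leaf_multisets t m"
  and admissible_True: "admissible True t m = restricted_leaf_multisets t m"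
  by (auto simp: admissible_def restricted_leaf_multisets_def)

lemma finite_admissible: "finite (admissible r t m)"
  unfolding admissible_def using finite_leaf_multisets [of t m] by simp

lemma append_in_leaf_multisets:
  assumes "length is = m"
  shows "is @ i # map (\<lambda>j. j + i) js \<in> leaf_multisets t (m + 1 + n) \<longleftrightarrow>
    i \<le> size t \<and> is \<in> leaf_multisets (fst (split_leaf t i)) m \<and>
    js \<in> leaf_multisets (snd (split_leaf t i)) n"
proof (cases "i \<le> size t")
  case True
  have "sorted (map (\<lambda>j. j + i) js) \<longleftrightarrow> sorted js"
    by (simp add: sorted_iff_nth_mono)
  moreover have "(\<forall>j\<in>set js. j + i \<le> size t) \<longleftrightarrow> (\<forall>j\<in>set js. j \<le> size t - i)"
    using True by auto
  ultimately show ?thesis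
    using True assms by (fastforce simp: leaf_multisets_def sorted_append)
qed (auto simp: leaf_multisets_def)

lemma split_leaf_eq_Leaf: "i \<le> size t \<Longrightarrow> fst (split_leaf t i) = Leaf \<longleftrightarrow> i = 0"
  using size_split_leaf_fst [of i t] by (cases "fst (split_leaf t i)") auto

lemma split_leaves_Leaf: "split_leaves Leaf is ! 0 = Leaf"
  by (cases "is") auto

lemma append_in_admissible:
  assumes "length is = m"
  shows "is @ i # map (\<lambda>j. j + i) js \<in> admissible r t (m + 1 + n) \<longleftrightarrow>
    i \<in> {of_bool r..size t} \<and> is \<in> admissible r (fst (split_leaf t i)) m \<and>
    js \<in> leaf_multisets (snd (split_leaf t i)) n"
proof (cases "i \<le> size t \<and> is \<in> leaf_multisets (fst (split_leaf t i)) m")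
  case True
  then have "split_leaves t (is @ i # map (\<lambda>j. j + i) js) =
      split_leaves (fst (split_leaf t i)) is @ split_leaves (snd (split_leaf t i)) js"
    by (intro split_leaves_append) (auto simp: leaf_multisets_def)
  then have "split_leaves t (is @ i # map (\<lambda>j. j + i) js) ! 0 = split_leaves (fst (split_leaf t i)) is ! 0"
    by (simp add: nth_append)
  moreover have "i \<ge> 1" if "split_leaves (fst (split_leaf t i)) is ! 0 \<noteq> Leaf"
    using that split_leaf_eq_Leaf [of i t] True split_leaves_Leaf [of "is"] by (cases i) auto
  ultimately show ?thesis
    using append_in_leaf_multisets [OF assms, of i js t n] True by (auto simp: admissible_def)
next
  case False
  then show ?thesis
    using append_in_leaf_multisets [OF assms, of i js t n] by (auto simp: admissible_def)
qed

text \<open>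
  Choosing \<open>m + 1 + n\<close> leaves amounts to choosing the one at position \<open>m\<close> first.  For a graft onto
  \<open>Vee u v\<close> with \<open>m = size u\<close> and \<open>n = size v\<close> this gives the recursion that defines \<open>tprod\<close>.
\<close>

lemma sum_admissible:
  "(\<Sum>is\<in>admissible r t (m + 1 + n). F is) =
    (\<Sum>i\<in>{of_bool r..size t}. \<Sum>is\<in>admissible r (fst (split_leaf t i)) m.
      \<Sum>js\<in>leaf_multisets (snd (split_leaf t i)) n. F (is @ i # map (\<lambda>j. j + i) js))"
proof -
  let ?S = "SIGMA i:{of_bool r..size t}. admissible r (fst (split_leaf t i)) m \<times>
    leaf_multisets (snd (split_leaf t i)) n"
  let ?join = "\<lambda>(i, is, js). is @ i # map (\<lambda>j. j + i) js"
  let ?cut = "\<lambda>xs. (xs ! m, take m xs, map (\<lambda>k. k - xs ! m) (drop (Suc m) xs))"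
  have len: "length is = m" if "is \<in> admissible r t' m" for "is" t'
    using that by (auto simp: admissible_def leaf_multisets_def)
  have join_cut: "?join (?cut xs) = xs" if xs: "xs \<in> admissible r t (m + 1 + n)" for xs
  proof -
    have l: "length xs = m + 1 + n" and s: "sorted xs"
      using xs by (auto simp: admissible_def leaf_multisets_def)
    have xs_eq: "xs = take m xs @ xs ! m # drop (Suc m) xs"
      using l by (simp add: id_take_nth_drop)
    have "xs ! m \<le> k" if "k \<in> set (drop (Suc m) xs)" for k
      using s that by (subst (asm) xs_eq) (auto simp: sorted_append)
    then have "map (\<lambda>j. j + xs ! m) (map (\<lambda>k. k - xs ! m) (drop (Suc m) xs)) = drop (Suc m) xs"
      by (auto intro!: map_idI simp: comp_def)
    then show ?thesis using xs_eq by simp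
  qed
  have "(\<Sum>xs\<in>admissible r t (m + 1 + n). F xs) = (\<Sum>p\<in>?S. F (?join p))"
  proof (rule sum.reindex_bij_witness [where i = ?join and j = ?cut])
    fix xs assume xs: "xs \<in> admissible r t (m + 1 + n)"
    show "?join (?cut xs) = xs" by (rule join_cut [OF xs])
    then show "F (?join (?cut xs)) = F xs" by simp
    have "length (take m xs) = m" using xs by (auto simp: admissible_def leaf_multisets_def)
    from append_in_admissible [OF this, of "xs ! m" "map (\<lambda>k. k - xs ! m) (drop (Suc m) xs)" r t n]
    show "?cut xs \<in> ?S" using join_cut [OF xs] xs by simp
  next
    fix p assume p: "p \<in> ?S"
    then obtain i "is" js where p_eq: "p = (i, is, js)" and i: "i \<in> {of_bool r..size t}"
      "is \<in> admissible r (fst (split_leaf t i)) m" "js \<in> leaf_multisets (snd (split_leaf t i)) n"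
      by auto
    show "?join p \<in> admissible r t (m + 1 + n)"
      using append_in_admissible [OF len [OF i(2)], of i js r t n] i p_eq by simp
    show "?cut (?join p) = p" using len [OF i(2)] by (simp add: p_eq nth_append comp_def)
  qed
  also have "\<dots> = (\<Sum>i\<in>{of_bool r..size t}. \<Sum>q\<in>admissible r (fst (split_leaf t i)) m \<times>
      leaf_multisets (snd (split_leaf t i)) n. F (?join (i, q)))"
    by (subst sum.Sigma) (auto simp: finite_admissible finite_leaf_multisets split_beta)
  finally show ?thesis
    by (simp add: sum.cartesian_product split_beta)
qed

definition labp :: "pbt \<times> nat set \<Rightarrow> bool tree" where
  "labp b = lab (fst b) (snd b)"

lemma bgraft_range:
  assumes "length bs = size s + 1" "\<And>u U. (u, U) \<in> set bs \<Longrightarrow> U \<subseteq> {..size u}"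
  shows "snd (bgraft bs s) \<subseteq> {..size (fst (bgraft bs s))}"
  using assms
proof (induction s arbitrary: bs)
  case Leaf
  then show ?case by (cases bs) (auto simp: bgraft_Leaf prod_eq_iff)
next
  case (Vee l r)
  obtain gl Gl gr Gr
    where g: "bgraft (take (size l + 1) bs) l = (gl, Gl)" "bgraft (drop (size l + 1) bs) r = (gr, Gr)"
    by fastforce
  have "Gl \<subseteq> {..size gl}"
    using Vee.IH(1) [of "take (size l + 1) bs"] Vee.prems g by (auto dest: in_set_takeD)
  moreover have "Gr \<subseteq> {..size gr}"
    using Vee.IH(2) [of "drop (size l + 1) bs"] Vee.prems g by (auto dest: in_set_dropD)
  ultimately show ?case
    unfolding bgraft_Vee [OF Vee.prems(1) g] by fastforce
qed

lemma labp_bgraft_Vee: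
  assumes "length bs = size l + 1" "length cs = size r + 1"
    and "\<And>u U. (u, U) \<in> set bs \<Longrightarrow> U \<subseteq> {..size u}"
  shows "labp (bgraft (bs @ cs) (Vee l r)) = \<langle>labp (bgraft bs l), True, labp (bgraft cs r)\<rangle>"
proof -
  obtain gl Gl gr Gr where g: "bgraft bs l = (gl, Gl)" "bgraft cs r = (gr, Gr)" by fastforce
  have "Gl \<subseteq> {..size gl}" using bgraft_range [of bs l] assms g by simp
  moreover have "bgraft (bs @ cs) (Vee l r) =
      (Vee gl gr, Gl \<union> {size gl + 1} \<union> (\<lambda>i. i + (size gl + 1)) ` Gr)"
    by (rule bgraft_Vee) (use assms g in auto)
  moreover have "lab gl (Gl \<union> {size gl + 1} \<union> (\<lambda>i. i + (size gl + 1)) ` Gr) = lab gl Gl"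
    by (rule lab_cong) auto
  moreover have "lab gr {i. i + (size gl + 1) \<in> Gl \<union> {size gl + 1} \<union> (\<lambda>i. i + (size gl + 1)) ` Gr} = lab gr Gr"
    by (rule lab_cong) (use \<open>Gl \<subseteq> {..size gl}\<close> in fastforce)
  ultimately show ?thesis using g by (simp add: labp_def)
qed

text \<open>
  All nodes of the tree \<open>s\<close> grafted onto belong to the order ideal of the result, whence its labels
  \<open>True\<close>.
\<close>

lemma tprod_lab:
  assumes "r \<longrightarrow> t \<noteq> Leaf"
  shows "tprod r (lab t T) (full s) =
    (\<Sum>is\<in>admissible r t (size s). basis_vec (labp (bgraft (bsplit (t, T) is) s)) ::
      bool tree \<Rightarrow>\<^sub>0 'k::field)"
  using assms
proof (induction s arbitrary: r t T)
  case Leaf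
  have "lab t {i. Suc 0 \<le> i \<and> i \<le> size t \<and> i \<in> T} = lab t T" by (rule lab_cong) auto
  moreover have "admissible r t 0 = {[]}"
    using Leaf by (auto simp: admissible_def leaf_multisets_def)
  ultimately show ?case by (simp add: bsplit_def bgraft_Leaf labp_def)
next
  case (Vee u v)
  have size_Vee: "size (Vee u v) = size u + 1 + size v" by simp
  have "(\<Sum>xs\<in>admissible r t (size (Vee u v)). basis_vec (labp (bgraft (bsplit (t, T) xs) (Vee u v))) ::
      bool tree \<Rightarrow>\<^sub>0 'k) =
    (\<Sum>i\<in>{of_bool r..size t}. \<Sum>is\<in>admissible r (fst (split_leaf t i)) (size u).
      \<Sum>js\<in>leaf_multisets (snd (split_leaf t i)) (size v).
        basis_vec (labp (bgraft (bsplit (t, T) (is @ i # map (\<lambda>j. j + i) js)) (Vee u v))))"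
    unfolding size_Vee by (rule sum_admissible)
  also have "\<dots> = (\<Sum>i\<in>{of_bool r..size t}. \<Sum>is\<in>admissible r (fst (split_leaf t i)) (size u).
      \<Sum>js\<in>leaf_multisets (snd (split_leaf t i)) (size v). basis_vec
        \<langle>labp (bgraft (bsplit (fst (split_leaf t i), T) is) u), True,
         labp (bgraft (bsplit (snd (split_leaf t i), {j. j + i \<in> T}) js) v)\<rangle>)"
  proof (intro sum.cong refl)
    fix i "is" js
    assume i: "i \<in> {of_bool r..size t}" and "is": "is \<in> admissible r (fst (split_leaf t i)) (size u)"
      and js: "js \<in> leaf_multisets (snd (split_leaf t i)) (size v)"
    have *: "sorted is" "set is \<subseteq> {..i}" "i \<le> size t" "length is = size u" "length js = size v"
      using i "is" js by (auto simp: admissible_def leaf_multisets_def)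
    show "(basis_vec (labp (bgraft (bsplit (t, T) (is @ i # map (\<lambda>j. j + i) js)) (Vee u v))) ::
        bool tree \<Rightarrow>\<^sub>0 'k) =
      basis_vec \<langle>labp (bgraft (bsplit (fst (split_leaf t i), T) is) u), True,
         labp (bgraft (bsplit (snd (split_leaf t i), {j. j + i \<in> T}) js) v)\<rangle>"
      unfolding bsplit_append [OF *(1-3)]
      by (subst labp_bgraft_Vee) (auto simp: *, auto simp: bsplit_def)
  qed
  also have "\<dots> = (\<Sum>i\<in>{of_bool r..size t}. 
      lin_ext (\<lambda>x. lin_ext (\<lambda>y. basis_vec \<langle>x, True, y\<rangle>)
        (tprod False (lab (snd (split_leaf t i)) {j. j + i \<in> T}) (full v)))
        (tprod r (lab (fst (split_leaf t i)) T) (full u)))"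
  proof (intro sum.cong refl)
    fix i assume i: "i \<in> {of_bool r..size t}"
    then have "r \<longrightarrow> fst (split_leaf t i) \<noteq> Leaf" by (auto simp: split_leaf_eq_Leaf)
    note IH = Vee.IH(1) [OF this] Vee.IH(2) [of False, simplified admissible_False]
    show "(\<Sum>is\<in>admissible r (fst (split_leaf t i)) (size u).
      \<Sum>js\<in>leaf_multisets (snd (split_leaf t i)) (size v). basis_vec
        \<langle>labp (bgraft (bsplit (fst (split_leaf t i), T) is) u), True,
         labp (bgraft (bsplit (snd (split_leaf t i), {j. j + i \<in> T}) js) v)\<rangle> :: bool tree \<Rightarrow>\<^sub>0 'k) =
      lin_ext (\<lambda>x. lin_ext (\<lambda>y. basis_vec \<langle>x, True, y\<rangle>)
        (tprod False (lab (snd (split_leaf t i)) {j. j + i \<in> T}) (full v)))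
        (tprod r (lab (fst (split_leaf t i)) T) (full u))"
      using IH by (simp add: lin_ext_sum)
  qed
  also have "\<dots> = tprod r (lab t T) (full (Vee u v))"
    by (simp add: tsplit_lab lin_ext_sum)
  finally show ?case ..
qed

section \<open>Passing to labelled trees\<close>

lemma bsplit_full: "bsplit (t, UNIV) is = map (\<lambda>u. (u, {1..size u})) (split_leaves t is)"
  by (rule nth_equalityI) (auto simp: bsplit_def)

text \<open>Products of plain trees are the case in which every node lies in the distinguished set.\<close>

lemma bgraft_full:
  assumes "length ts = size s + 1"
  shows "bgraft (map (\<lambda>u. (u, {1..size u})) ts) s = (graft ts s, {1..size (graft ts s)})"
  using assms
proof (induction s arbitrary: ts)
  case Leaf
  then show ?case by (cases ts) (auto simp: bgraft_Leaf)
next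
  case (Vee l r)
  let ?gl = "graft (take (size l + 1) ts) l" and ?gr = "graft (drop (size l + 1) ts) r"
  have "bgraft (map (\<lambda>u. (u, {1..size u})) ts) (Vee l r) =
      (Vee ?gl ?gr, {1..size ?gl} \<union> {size ?gl + 1} \<union> (\<lambda>i. i + (size ?gl + 1)) ` {1..size ?gr})"
    by (rule bgraft_Vee)
      (use Vee.prems in \<open>auto simp: take_map drop_map Vee.IH simp del: One_nat_def\<close>)
  also have "{1..size ?gl} \<union> {size ?gl + 1} \<union> (\<lambda>i. i + (size ?gl + 1)) ` {1..size ?gr} =
      {1..size (Vee ?gl ?gr)}"
    unfolding image_add_atLeastAtMost' by auto
  finally show ?case by simp
qed

lemma labp_full: "labp (t, {1..size t}) = full t"
  unfolding labp_def fst_conv snd_conv by (rule lab_cong) auto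

lemma admissible_one: "admissible r t 1 = (\<lambda>i. [i]) ` {of_bool r..size t}"
proof -
  have "is \<in> admissible r t 1 \<longleftrightarrow> is \<in> (\<lambda>i. [i]) ` {of_bool r..size t}" for "is"
  proof (cases "length is = 1")
    case True
    then obtain i where "is = [i]" by (auto simp: length_Suc_conv)
    then show ?thesis
      by (cases r) (auto simp: admissible_def leaf_multisets_def split_beta split_leaf_eq_Leaf)
  qed (auto simp: admissible_def leaf_multisets_def)
  then show ?thesis by blast
qed

lemma inj_full: "inj full"
  using lab_inject by (blast intro: injI)

lemma ysym_mult_basis:
  "ysym_mult (basis_vec (t, s)) = (\<Sum>is\<in>leaf_multisets t (size s). basis_vec (graft (split_leaves t is) s))"
  by (simp add: ysym_mult_def)

lemma ysym_comult_basis: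
  "ysym_comult (basis_vec t) =
    (\<Sum>i\<in>{0..size t}. basis_vec (fst (split_leaf t i), snd (split_leaf t i)))"
  unfolding ysym_comult_def lin_ext_basis_vec admissible_False [symmetric] admissible_one
  by (subst sum.reindex) (auto simp: inj_on_def split_beta)

lemma push_full_ysym_mult:
  "push full (ysym_mult (basis_vec (t, s))) = tprod False (full t) (full s)"
  unfolding ysym_mult_basis push_sum tprod_lab [of False t, simplified] admissible_False
  by (rule sum.cong) (auto simp: bsplit_full bgraft_full labp_full leaf_multisets_def simp del: One_nat_def)

lemma push_full_ysym_comult:
  "push (map_prod full full) (ysym_comult (basis_vec t)) = tsplit False (full t)"
  unfolding ysym_comult_basis push_sum tsplit_lab by (simp add: map_prod_def split_beta)

definition mlab :: "mtree \<Rightarrow> bool tree" where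
  "mlab b = labp (Rep_mtree b)"

lemma bileveled_imp_upper_ideal: "bileveled b \<Longrightarrow> snd b \<subseteq> {1..size (fst b)} \<and> fst b \<noteq> Leaf"
  by (auto simp: bileveled_def upper_ideal_def)

lemma inj_mlab: "inj mlab"
proof (rule injI)
  fix b c assume eq: "mlab b = mlab c"
  let ?b = "Rep_mtree b" and ?c = "Rep_mtree c"
  have "snd ?b \<subseteq> {1..size (fst ?b)}" "snd ?c \<subseteq> {1..size (fst ?c)}"
    using Rep_mtree [of b] Rep_mtree [of c] bileveled_imp_upper_ideal by blast+
  moreover have "fst ?b = fst ?c \<and> snd ?b \<inter> {1..size (fst ?b)} = snd ?c \<inter> {1..size (fst ?b)}"
    using eq lab_inject unfolding mlab_def labp_def by blast
  ultimately have "?b = ?c" by (metis Int_absorb2 prod_eq_iff)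
  then show "b = c" by (simp add: Rep_mtree_inject)
qed

lemma mlab_Abs_mtree: "bileveled b \<Longrightarrow> mlab (Abs_mtree b) = labp b"
  by (simp add: mlab_def Abs_mtree_inverse)

lemma mlab_not_Leaf: "mlab b \<noteq> \<langle>\<rangle>"
  using Rep_mtree [of b] bileveled_imp_upper_ideal by (auto simp: mlab_def labp_def)

lemma push_mlab_msym_act:
  "push mlab (msym_act (basis_vec (b, s))) = tprod True (mlab b) (full s)"
proof -
  obtain t T where b: "Rep_mtree b = (t, T)" by fastforce
  have bl: "bileveled (t, T)" using Rep_mtree [of b] b by simp
  then have t: "t \<noteq> Leaf" using bileveled_imp_upper_ideal by force
  have "push mlab (msym_act (basis_vec (b, s))) =
      (\<Sum>is\<in>admissible True t (size s). basis_vec (mlab (Abs_mtree (bgraft (bsplit (t, T) is) s))))"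
    by (simp add: msym_act_def underlying_tree_def b push_sum admissible_True)
  also have "\<dots> = (\<Sum>is\<in>admissible True t (size s). basis_vec (labp (bgraft (bsplit (t, T) is) s)))"
    using bileveled_bgraft_bsplit [OF bl] by (simp add: admissible_True mlab_Abs_mtree)
  also have "\<dots> = tprod True (lab t T) (full s)"
    using t by (subst tprod_lab) auto
  finally show ?thesis by (simp add: mlab_def labp_def b)
qed

abbreviation label_all :: "bool tree \<Rightarrow> bool tree" where
  "label_all \<equiv> map_tree (\<lambda>_. True)"

text \<open>
  The coaction keeps only the underlying tree of the second part; embedded by \<open>full\<close>, that tree is the
  second part with all labels changed to \<open>True\<close>.
\<close>

lemma push_mlab_msym_coact:
  "push (map_prod mlab full) (msym_coact (basis_vec b)) =
    push (map_prod id label_all) (tsplit True (mlab b))"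
proof -
  obtain t T where b: "Rep_mtree b = (t, T)" by fastforce
  have bl: "bileveled (t, T)" using Rep_mtree [of b] b by simp
  have "push (map_prod mlab full) (msym_coact (basis_vec b)) =
      (\<Sum>is\<in>admissible True t 1.
        basis_vec (mlab (Abs_mtree (bsplit (t, T) is ! 0)), full (fst (bsplit (t, T) is ! 1))))"
    by (simp add: msym_coact_def underlying_tree_def b push_sum admissible_True)
  also have "\<dots> = (\<Sum>is\<in>admissible True t 1.
      basis_vec (labp (bsplit (t, T) is ! 0), full (fst (bsplit (t, T) is ! 1))))"
    using bileveled_bsplit [OF bl] by (simp add: admissible_True mlab_Abs_mtree)
  also have "\<dots> = (\<Sum>i\<in>{of_bool True..size t}.
      basis_vec (labp (bsplit (t, T) [i] ! 0), full (fst (bsplit (t, T) [i] ! 1))))"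
    unfolding admissible_one by (subst sum.reindex) (auto simp: inj_on_def)
  also have "\<dots> = (\<Sum>i\<in>{of_bool True..size t}.
      basis_vec (lab (fst (split_leaf t i)) T, full (snd (split_leaf t i))))"
  proof (rule sum.cong [OF refl])
    fix i
    have "lab (fst (split_leaf t i)) {j \<in> {1..size (fst (split_leaf t i))}. j \<in> T} =
        lab (fst (split_leaf t i)) T"
      by (rule lab_cong) auto
    then show "basis_vec (labp (bsplit (t, T) [i] ! 0), full (fst (bsplit (t, T) [i] ! 1))) =
      (basis_vec (lab (fst (split_leaf t i)) T, full (snd (split_leaf t i))) ::
        bool tree \<times> bool tree \<Rightarrow>\<^sub>0 rat)"
      by (simp add: bsplit_def labp_def split_beta)
  qed
  also have "\<dots> = push (map_prod id label_all) (tsplit True (mlab b))"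
    unfolding mlab_def labp_def b fst_conv snd_conv tsplit_lab push_sum by simp
  finally show ?thesis .
qed


section \<open>Transport of identities\<close>

text \<open>
  If the maps \<open>f, g, h, k\<close> of bases carry operations \<open>m, d, n\<close> to operations \<open>P, Q\<close> on basis elements,
  they carry the two sides of each axiom to the corresponding expressions in \<open>P\<close> and \<open>Q\<close>.
\<close>

lemma push_id [simp]: "push id x = x"
  by (simp add: push_def)

lemma push_action:
  assumes "linear_map m" "\<And>a b. push f (m (basis_vec (a, b))) = P (f a) (h b)"
  shows "push f (m (x \<otimes> y)) = lin_ext (\<lambda>a. lin_ext (P a) (push h y)) (push f x)"
proof -
  interpret m: Vector_Spaces.linear scl scl m by (rule assms(1))
  show ?thesis
  proof (induction x rule: basis_induct)
    case (basis a)
    show ?case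
      by (induction y rule: basis_induct) (simp_all add: multilinear push_linear assms(2) m.add m.scale)
  qed (simp_all add: multilinear push_linear m.add m.scale)
qed

lemma push_coaction:
  assumes "linear_map d" "\<And>a. push k (d (basis_vec a)) = Q (f a)"
  shows "push k (d x) = lin_ext Q (push f x)"
proof -
  interpret d: Vector_Spaces.linear scl scl d by (rule assms(1))
  show ?thesis
    by (induction x rule: basis_induct)
      (simp_all add: multilinear push_linear d.add d.scale assms(2))
qed

lemma push_tensor_assoc:
  "push (map_prod f (map_prod g h)) (tensor_assoc (u \<otimes> basis_vec c)) =
    lin_ext (\<lambda>q. basis_vec (fst q, snd q, h c)) (push (map_prod f g) u)"
  by (induction u rule: basis_induct) (auto simp: multilinear push_def tensor_assoc_def split_beta)

lemma push_assoc_left: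
  assumes "\<And>a. push (map_prod f g) (d (basis_vec a)) = P (f a)"
  shows "push (map_prod f (map_prod g h)) (tensor_assoc (tensor_map d id x)) =
    lin_ext (\<lambda>p. lin_ext (\<lambda>q. basis_vec (fst q, snd q, snd p)) (P (fst p))) (push (map_prod f h) x)"
proof (induction x rule: basis_induct)
  case (basis a)
  show ?case by (simp add: tensor_map_def split_beta push_tensor_assoc assms)
qed (simp_all add: tensor_map_def tensor_assoc_def push_def multilinear)

lemma push_assoc_right:
  assumes "\<And>a. push (map_prod g h) (d (basis_vec a)) = Q (k a)"
  shows "push (map_prod f (map_prod g h)) (tensor_map id d x) =
    lin_ext (\<lambda>p. lin_ext (\<lambda>q. basis_vec (fst p, fst q, snd q)) (Q (snd p))) (push (map_prod f k) x)"
proof (induction x rule: basis_induct)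
  case (basis a)
  show ?case
    by (simp add: tensor_map_def split_beta push_tensor assms) (simp add: tensor_def)
qed (simp_all add: tensor_map_def push_def multilinear)

lemma push_exchange:
  assumes "\<And>a b. push f (m (basis_vec (a, b))) = P (f a) (h b)"
    and "\<And>a b. push g (n (basis_vec (a, b))) = Q (g a) (k b)"
  shows "push (map_prod f g) (tensor_map m n (tensor_exchange (x \<otimes> y))) =
    lin_ext (\<lambda>p. lin_ext (\<lambda>q. P (fst p) (fst q) \<otimes> Q (snd p) (snd q)) (push (map_prod h k) y))
      (push (map_prod f g) x)"
proof (induction x rule: basis_induct)
  case (basis p)
  show ?case
  proof (induction y rule: basis_induct)
    case (basis q)
    have "tensor_map m n (tensor_exchange (basis_vec p \<otimes> basis_vec q)) =
        m (basis_vec (fst p, fst q)) \<otimes> n (basis_vec (snd p, snd q))"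
      by (simp add: tensor_map_def tensor_exchange_def split_beta)
    then show ?case by (simp add: push_tensor assms)
  qed (simp_all add: tensor_map_def tensor_exchange_def push_def multilinear)
qed (simp_all add: tensor_map_def tensor_exchange_def push_def multilinear)

lemma ysym_counit_basis: "ysym_counit (basis_vec t) = (if t = Leaf then 1 else 0)"
  by (simp add: ysym_counit_def lookup_single when_def)

lemma push_contract_right:
  "push f (contract_right ysym_counit x) =
    lin_ext (\<lambda>p. if snd p = \<langle>\<rangle> then basis_vec (fst p) else 0) (push (map_prod f full) x)"
  by (induction x rule: basis_induct)
    (simp_all add: contract_right_def push_def multilinear split_beta ysym_counit_basis)

lemma push_contract_left:
  "push f (contract_left ysym_counit x) =
    lin_ext (\<lambda>p. if fst p = \<langle>\<rangle> then basis_vec (snd p) else 0) (push (map_prod full f) x)"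
  by (induction x rule: basis_induct)
    (simp_all add: contract_left_def push_def multilinear split_beta ysym_counit_basis)

section \<open>Antipodes\<close>

context bialgebra
begin

definition conv :: "(('h \<Rightarrow>\<^sub>0 'k) \<Rightarrow> ('h \<Rightarrow>\<^sub>0 'k)) \<Rightarrow> (('h \<Rightarrow>\<^sub>0 'k) \<Rightarrow> ('h \<Rightarrow>\<^sub>0 'k)) \<Rightarrow>
    ('h \<Rightarrow>\<^sub>0 'k) \<Rightarrow> ('h \<Rightarrow>\<^sub>0 'k)" where
  "conv f g x = mult (tensor_map f g (comult x))"

lemma conv_alt:
  "conv f g x = lin_ext (\<lambda>p. mult (f (basis_vec (fst p)) \<otimes> g (basis_vec (snd p)))) (comult x)"
  by (simp add: conv_def tensor_map_def linear_lin_ext_comp [OF mult_linear] split_beta)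

lemma coassoc_lin_ext:
  "lin_ext (\<lambda>p. lin_ext (\<lambda>q. F (fst q) (snd q) (snd p)) (comult (basis_vec (fst p)))) (comult x) =
   lin_ext (\<lambda>p. lin_ext (\<lambda>q. F (fst p) (fst q) (snd q)) (comult (basis_vec (snd p)))) (comult x)"
proof -
  have "lin_ext (\<lambda>(a, b, c). F a b c) (tensor_assoc (tensor_map comult id (comult x))) =
      lin_ext (\<lambda>(a, b, c). F a b c) (tensor_map id comult (comult x))"
    by (simp only: coassoc)
  then show ?thesis
    by (simp add: tensor_assoc_def tensor_map_def lin_ext_lin_ext lin_ext_tensor split_beta)
qed

lemma conv_assoc: "conv (conv f g) h x = conv f (conv g h) x"
proof -
  have "conv (conv f g) h x = lin_ext (\<lambda>p. lin_ext (\<lambda>q.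
      mult (mult (f (basis_vec (fst q)) \<otimes> g (basis_vec (snd q))) \<otimes> h (basis_vec (snd p))))
      (comult (basis_vec (fst p)))) (comult x)"
    by (simp add: conv_alt [of "conv f g"] conv_alt [of f g] lin_ext_tensor_left
        linear_lin_ext_comp [OF mult_linear])
  also have "\<dots> = lin_ext (\<lambda>p. lin_ext (\<lambda>q.
      mult (f (basis_vec (fst p)) \<otimes> mult (g (basis_vec (fst q)) \<otimes> h (basis_vec (snd q)))))
      (comult (basis_vec (snd p)))) (comult x)"
    unfolding mult_assoc
    by (rule coassoc_lin_ext [of "\<lambda>a b c. mult (f (basis_vec a) \<otimes> mult (g (basis_vec b) \<otimes> h (basis_vec c)))"])
  also have "\<dots> = conv f (conv g h) x"
    by (simp add: conv_alt [of f "conv g h"] conv_alt [of g h] lin_ext_tensor_right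
        linear_lin_ext_comp [OF mult_linear])
  finally show ?thesis .
qed

lemma conv_unit_right:
  assumes "linear_map f"
  shows "conv f (\<lambda>x. scl (counit x) unit) x = f x"
proof -
  have "f x = f (contract_right counit (comult x))" by (simp add: counit_right)
  also have "\<dots> = conv f (\<lambda>x. scl (counit x) unit) x"
    by (simp add: conv_alt contract_right_def linear_lin_ext_comp [OF assms] split_beta
        tensor_scl_right linear_map_scl [OF mult_linear] mult_unit_right linear_map_scl [OF assms])
  finally show ?thesis ..
qed

lemma conv_unit_left:
  assumes "linear_map f"
  shows "conv (\<lambda>x. scl (counit x) unit) f x = f x"
proof -
  have "f x = f (contract_left counit (comult x))" by (simp add: counit_left)
  also have "\<dots> = conv (\<lambda>x. scl (counit x) unit) f x"
    by (simp add: conv_alt contract_left_def linear_lin_ext_comp [OF assms] split_beta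
        tensor_scl_left linear_map_scl [OF mult_linear] mult_unit_left linear_map_scl [OF assms])
  finally show ?thesis ..
qed

text \<open>
  Let \<open>S\<close> be a right inverse of \<open>id\<close>, and \<open>g\<close> a right inverse of \<open>S\<close>.  Then \<open>id = id * S * g = g\<close>, so
  that \<open>S\<close> is a left inverse of \<open>id\<close> as well.
\<close>

lemma hopf_algebra_if_right_inverses:
  assumes inv: "\<And>f. linear_map f \<Longrightarrow> f unit = unit \<Longrightarrow>
    \<exists>g. linear_map g \<and> g unit = unit \<and> (\<forall>x. conv f g x = scl (counit x) unit)"
  shows "hopf_algebra mult unit comult counit"
proof unfold_locales
  have "linear_map (id :: ('h \<Rightarrow>\<^sub>0 'k) \<Rightarrow> _)" by unfold_locales simp_all
  then obtain S where S: "linear_map S" "S unit = unit" "\<And>x. conv id S x = scl (counit x) unit"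
    using inv [of id] by auto
  then obtain g where g: "linear_map g" "\<And>x. conv S g x = scl (counit x) unit"
    using inv [of S] by auto
  have "g x = x" for x
  proof -
    have "g x = conv (conv id S) g x"
      using conv_unit_left [OF g(1)] S(3) by (simp add: conv_alt)
    also have "\<dots> = conv id (\<lambda>x. scl (counit x) unit) x"
      unfolding conv_assoc using g(2) by (simp add: conv_alt)
    also have "\<dots> = x"
      using conv_unit_right [OF \<open>linear_map id\<close>] by simp
    finally show ?thesis .
  qed
  then have "g = id" by auto
  with S g show "\<exists>S. linear_map S \<and>
      (\<forall>x. mult (tensor_map S id (comult x)) = scl (counit x) unit \<and>
           mult (tensor_map id S (comult x)) = scl (counit x) unit)"
    unfolding conv_def by blast
qed

end


section \<open>The Loday--Ronco Hopf algebra and its module\<close>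

lemma linear_ysym_mult: "linear_map ysym_mult"
  and linear_ysym_comult: "linear_map ysym_comult"
  and linear_msym_act: "linear_map msym_act"
  and linear_msym_coact: "linear_map msym_coact"
  unfolding ysym_mult_def ysym_comult_def msym_act_def msym_coact_def by (rule linear_lin_ext)+

lemma push_ysym_mult:
  "push full (ysym_mult (x \<otimes> y)) = lin_ext (\<lambda>a. lin_ext (tprod False a) (push full y)) (push full x)"
  by (rule push_action [where P = "tprod False" and f = full and h = full, OF linear_ysym_mult push_full_ysym_mult])

lemma push_msym_act:
  "push mlab (msym_act (x \<otimes> y)) = lin_ext (\<lambda>a. lin_ext (tprod True a) (push full y)) (push mlab x)"
  by (rule push_action [where P = "tprod True" and f = mlab and h = full, OF linear_msym_act push_mlab_msym_act])

lemma push_ysym_comult: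
  "push (map_prod full full) (ysym_comult x) = lin_ext (tsplit False) (push full x)"
  by (rule push_coaction [where f = full and Q = "tsplit False", OF linear_ysym_comult push_full_ysym_comult])

lemma push_msym_coact:
  "push (map_prod mlab full) (msym_coact x) =
    lin_ext (\<lambda>a. push (map_prod id label_all) (tsplit True a)) (push mlab x)"
  by (rule push_coaction [where f = mlab, OF linear_msym_coact push_mlab_msym_coact])

text \<open>The bilinear form of \<open>tprod_assoc\<close>.\<close>

lemma action_assoc:
  "lin_ext (\<lambda>a. lin_ext (tprod r a) Z) (lin_ext (\<lambda>a. lin_ext (tprod r a) Y) X) =
    lin_ext (\<lambda>a. lin_ext (tprod r a) (lin_ext (\<lambda>b. lin_ext (tprod False b) Z) Y)) X"
proof -
  have "lin_ext (\<lambda>w. lin_ext (tprod r w) Z) (tprod r a b) =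
      lin_ext (\<lambda>c. lin_ext (tprod r a) (tprod False b c)) Z" for a b
    by (subst lin_ext_swap) (simp add: tprod_assoc)
  then show ?thesis by (simp add: lin_ext_lin_ext)
qed

lemma ysym_mult_assoc: "ysym_mult (ysym_mult (x \<otimes> y) \<otimes> z) = ysym_mult (x \<otimes> ysym_mult (y \<otimes> z))"
  by (rule injD [OF inj_push [OF inj_full]]) (simp only: push_ysym_mult action_assoc)

lemma msym_act_assoc: "msym_act (msym_act (v \<otimes> x) \<otimes> y) = msym_act (v \<otimes> ysym_mult (x \<otimes> y))"
  by (rule injD [OF inj_push [OF inj_mlab]]) (simp only: push_msym_act push_ysym_mult action_assoc)

lemma ysym_coassoc:
  "tensor_assoc (tensor_map ysym_comult id (ysym_comult x)) = tensor_map id ysym_comult (ysym_comult x)"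
proof (rule injD [OF inj_push [of "map_prod full (map_prod full full)"]])
  show "inj (map_prod full (map_prod full full))" by (intro prod.inj_map inj_full)
  show "push (map_prod full (map_prod full full)) (tensor_assoc (tensor_map ysym_comult id (ysym_comult x))) =
      push (map_prod full (map_prod full full)) (tensor_map id ysym_comult (ysym_comult x))"
    unfolding push_assoc_left [where d = ysym_comult and P = "tsplit False", OF push_full_ysym_comult]
      push_assoc_right [where d = ysym_comult and k = full and Q = "tsplit False", OF push_full_ysym_comult] push_ysym_comult lin_ext_lin_ext
    by (simp only: tsplit_coassoc [where f = "\<lambda>a b c. basis_vec (a, b, c)"])
qed

lemma msym_coassoc:
  "tensor_assoc (tensor_map msym_coact id (msym_coact v)) = tensor_map id ysym_comult (msym_coact v)"
proof (rule injD [OF inj_push [of "map_prod mlab (map_prod full full)"]])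
  show "inj (map_prod mlab (map_prod full full))" by (intro prod.inj_map inj_full inj_mlab)
  show "push (map_prod mlab (map_prod full full)) (tensor_assoc (tensor_map msym_coact id (msym_coact v))) =
      push (map_prod mlab (map_prod full full)) (tensor_map id ysym_comult (msym_coact v))"
    unfolding push_assoc_left [where d = msym_coact and f = mlab, OF push_mlab_msym_coact]
      push_assoc_right [where d = ysym_comult and k = full and Q = "tsplit False", OF push_full_ysym_comult] push_msym_coact lin_ext_lin_ext
    by (simp add: lin_ext_push tsplit_map_tree map_prod_def split_beta
        tsplit_coassoc [where f = "\<lambda>a b c. basis_vec (a, label_all b, label_all c)"])
qed

lemma ysym_comult_mult:
  "ysym_comult (ysym_mult (x \<otimes> y)) =
    tensor_map ysym_mult ysym_mult (tensor_exchange (ysym_comult x \<otimes> ysym_comult y))"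
proof (rule injD [OF inj_push [of "map_prod full full"]])
  show "inj (map_prod full full)" by (intro prod.inj_map inj_full)
  show "push (map_prod full full) (ysym_comult (ysym_mult (x \<otimes> y))) = push (map_prod full full)
      (tensor_map ysym_mult ysym_mult (tensor_exchange (ysym_comult x \<otimes> ysym_comult y)))"
    unfolding push_exchange [where P = "tprod False" and f = full and h = full and Q = "tprod False" and g = full
        and k = full, OF push_full_ysym_mult push_full_ysym_mult] push_ysym_comult push_ysym_mult
      lin_ext_lin_ext tsplit_tprod
    by (subst (2) lin_ext_swap) (rule refl)
qed

text \<open>
  On labelled trees this is the restricted form of \<open>tsplit_tprod\<close>, with the labels of the second
  factor set to \<open>True\<close>; that operation commutes with the product and fixes the parts of a plain tree.
\<close>

lemma msym_coact_act:
  "msym_coact (msym_act (v \<otimes> x)) =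
    tensor_map msym_act ysym_mult (tensor_exchange (msym_coact v \<otimes> ysym_comult x))"
proof (rule injD [OF inj_push [of "map_prod mlab full"]])
  show "inj (map_prod mlab full)" by (intro prod.inj_map inj_full inj_mlab)
  let ?X = "push full x" and ?V = "push mlab v" and ?\<pi> = "map_prod id label_all"
  define C where "C = push (map_prod full full) (ysym_comult x)"
  have C: "C = lin_ext (tsplit False) ?X" by (simp add: C_def push_ysym_comult)
  \<comment> \<open>\<open>C\<close> is supported on trees with all labels \<open>True\<close>\<close>
  have C_full: "lin_ext (\<lambda>q. h (fst q) (snd q)) C = lin_ext (\<lambda>q. h (fst q) (label_all (snd q))) C"
    for h :: "bool tree \<Rightarrow> bool tree \<Rightarrow> (bool tree \<times> bool tree \<Rightarrow>\<^sub>0 rat)"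
    by (simp add: C_def lin_ext_push)
  show "push (map_prod mlab full) (msym_coact (msym_act (v \<otimes> x))) = push (map_prod mlab full)
      (tensor_map msym_act ysym_mult (tensor_exchange (msym_coact v \<otimes> ysym_comult x)))"
  proof -
    have "lin_ext (\<lambda>w. push ?\<pi> (tsplit True w)) (tprod True a b) = lin_ext (\<lambda>p. lin_ext (\<lambda>q.
        tprod True (fst p) (fst q) \<otimes> tprod False (label_all (snd p)) (label_all (snd q)))
        (tsplit False b)) (tsplit True a :: bool tree \<times> bool tree \<Rightarrow>\<^sub>0 rat)" for a b
      unfolding push_lin_ext [symmetric] tsplit_tprod
      by (simp add: push_lin_ext push_tensor tprod_map_tree)
    then have "push (map_prod mlab full) (msym_coact (msym_act (v \<otimes> x))) =
        lin_ext (\<lambda>a. lin_ext (\<lambda>b. lin_ext (\<lambda>p. lin_ext (\<lambda>q.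
          tprod True (fst p) (fst q) \<otimes> tprod False (label_all (snd p)) (label_all (snd q)))
          (tsplit False b)) (tsplit True a)) ?X) ?V"
      by (simp add: push_msym_coact push_msym_act lin_ext_lin_ext)
    also have "\<dots> = lin_ext (\<lambda>a. lin_ext (\<lambda>p. lin_ext (\<lambda>q.
          tprod True (fst p) (fst q) \<otimes> tprod False (label_all (snd p)) (label_all (snd q))) C)
          (tsplit True a)) ?V"
      unfolding C lin_ext_lin_ext by (subst (2) lin_ext_swap) (rule refl)
    also have "\<dots> = lin_ext (\<lambda>a. lin_ext (\<lambda>p. lin_ext (\<lambda>q.
          tprod True (fst p) (fst q) \<otimes> tprod False (label_all (snd p)) (snd q)) C)
          (tsplit True a)) ?V"
      by (simp only: C_full [of "\<lambda>c d. tprod True (fst p) c \<otimes> tprod False (label_all (snd p)) d" for p])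
    also have "\<dots> = push (map_prod mlab full)
      (tensor_map msym_act ysym_mult (tensor_exchange (msym_coact v \<otimes> ysym_comult x)))"
      unfolding push_exchange [where P = "tprod True" and f = mlab and h = full and Q = "tprod False"
          and g = full and k = full, OF push_mlab_msym_act push_full_ysym_mult]
        push_msym_coact C_def lin_ext_lin_ext
      by (simp add: lin_ext_push)
    finally show ?thesis .
  qed
qed

lemma msym_coact_counit: "contract_right ysym_counit (msym_coact v) = v"
proof (rule injD [OF inj_push [OF inj_mlab]])
  have "lin_ext (\<lambda>a. lin_ext (\<lambda>p. if snd p = \<langle>\<rangle> then basis_vec (fst p) else 0) (tsplit True a)) (push mlab v)
    = push mlab v"
    unfolding lin_ext_push by (simp add: tsplit_counit_right mlab_not_Leaf push_def)
  then show "push mlab (contract_right ysym_counit (msym_coact v)) = push mlab v"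
    unfolding push_contract_right push_msym_coact
    by (simp add: lin_ext_lin_ext lin_ext_push cong: if_cong)
qed

lemma split_leaf_0: "split_leaf t 0 = (Leaf, t)"
  by (induction t) simp_all

lemma linear_ysym_counit: "linear_form ysym_counit"
  by unfold_locales (simp_all add: ysym_counit_def lookup_add algebra_simps)

lemma ysym_counit_mult: "ysym_counit (ysym_mult (x \<otimes> y)) = ysym_counit x * ysym_counit y"
proof (induction x rule: basis_induct)
  case (basis t)
  show ?case
  proof (induction y rule: basis_induct)
    case (basis s)
    have "leaf_multisets t 0 = {[]}" by (auto simp: leaf_multisets_def)
    then show ?case
      by (cases s) (simp_all add: ysym_counit_def ysym_mult_basis lookup_sum lookup_single)
  qed (simp_all add: ysym_mult_def multilinear ysym_counit_def lookup_add algebra_simps)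
qed (simp_all add: ysym_mult_def multilinear ysym_counit_def lookup_add algebra_simps)

lemma bialgebra_ysym: "bialgebra ysym_mult ysym_unit ysym_comult ysym_counit"
proof (intro bialgebra.intro unital_algebra.intro coalgebra.intro bialgebra_axioms.intro
    linear_ysym_mult linear_ysym_comult linear_ysym_counit)
  fix x y z :: ysym
  show "ysym_mult (ysym_mult (x \<otimes> y) \<otimes> z) = ysym_mult (x \<otimes> ysym_mult (y \<otimes> z))"
    by (rule ysym_mult_assoc)
  show "ysym_mult (ysym_unit \<otimes> x) = x"
    by (rule injD [OF inj_push [OF inj_full]])
      (simp add: push_ysym_mult ysym_unit_def tprod_Leaf_left)
  show "ysym_mult (x \<otimes> ysym_unit) = x"
    by (rule injD [OF inj_push [OF inj_full]]) (simp add: push_ysym_mult ysym_unit_def)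
  show "tensor_assoc (tensor_map ysym_comult id (ysym_comult x)) = tensor_map id ysym_comult (ysym_comult x)"
    by (rule ysym_coassoc)
  show "contract_left ysym_counit (ysym_comult x) = x"
    by (rule injD [OF inj_push [OF inj_full]])
      (simp add: push_contract_left push_ysym_comult lin_ext_lin_ext tsplit_counit_left)
  show "contract_right ysym_counit (ysym_comult x) = x"
    by (rule injD [OF inj_push [OF inj_full]])
      (simp add: push_contract_right push_ysym_comult lin_ext_lin_ext tsplit_counit_right)
  show "ysym_comult (ysym_mult (x \<otimes> y)) =
      tensor_map ysym_mult ysym_mult (tensor_exchange (ysym_comult x \<otimes> ysym_comult y))"
    by (rule ysym_comult_mult)
  show "ysym_comult ysym_unit = ysym_unit \<otimes> ysym_unit"
    by (simp add: ysym_unit_def ysym_comult_basis)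
  show "ysym_counit ysym_unit = 1" by (simp add: ysym_unit_def ysym_counit_basis)
  show "ysym_counit (ysym_mult (x \<otimes> y)) = ysym_counit x * ysym_counit y"
    by (rule ysym_counit_mult)
qed

text \<open>
  In the convolution of \<open>f\<close> and \<open>g\<close> at \<open>t\<close>, the splitting along leaf \<open>0\<close> contributes \<open>g t\<close> if \<open>f\<close>
  preserves the unit, and the other splittings involve \<open>g\<close> only at smaller trees.  So the equation
  for a right inverse \<open>g\<close> can be solved for \<open>g t\<close>.
\<close>

function right_inverse :: "(ysym \<Rightarrow> ysym) \<Rightarrow> pbt \<Rightarrow> ysym" where
  "right_inverse f t = (if t = Leaf then ysym_unit else
    - (\<Sum>i\<in>{1..size t}. ysym_mult
        (f (basis_vec (fst (split_leaf t i))) \<otimes> right_inverse f (snd (split_leaf t i)))))"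
  by auto
termination by (relation "measure (\<lambda>(f, t). size t)") auto

declare right_inverse.simps [simp del]

lemma hopf_algebra_ysym: "hopf_algebra ysym_mult ysym_unit ysym_comult ysym_counit"
proof -
  interpret Y: bialgebra ysym_mult ysym_unit ysym_comult ysym_counit
    by (rule bialgebra_ysym)
  show ?thesis
  proof (rule Y.hopf_algebra_if_right_inverses)
    fix f :: "ysym \<Rightarrow> ysym"
    assume f: "linear_map f" "f ysym_unit = ysym_unit"
    let ?g = "lin_ext (right_inverse f)"
    have unit: "?g ysym_unit = ysym_unit" by (simp add: ysym_unit_def right_inverse.simps)
    have comult: "ysym_comult (x + y) = ysym_comult x + ysym_comult y"
      "ysym_comult (scl c x) = scl c (ysym_comult x)" for c x y
      by (simp_all add: ysym_comult_def multilinear)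
    have "Y.conv f ?g x = scl (ysym_counit x) ysym_unit" for x
    proof (induction x rule: basis_induct)
      case (basis t)
      let ?m = "\<lambda>i. ysym_mult (f (basis_vec (fst (split_leaf t i))) \<otimes> right_inverse f (snd (split_leaf t i)))"
      have "Y.conv f ?g (basis_vec t) = (\<Sum>i\<in>{0..size t}. ?m i)"
        by (simp add: Y.conv_alt ysym_comult_basis lin_ext_sum)
      also have "\<dots> = ?m 0 + (\<Sum>i\<in>{1..size t}. ?m i)"
        by (simp add: sum.atLeast_Suc_atMost)
      also have "?m 0 = right_inverse f t"
        using f(2) by (simp add: split_leaf_0 ysym_unit_def [symmetric] Y.mult_unit_left)
      also have "right_inverse f t + (\<Sum>i\<in>{1..size t}. ?m i) = scl (ysym_counit (basis_vec t)) ysym_unit"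
        by (subst right_inverse.simps) (simp add: ysym_counit_basis)
      finally show ?case .
    qed (simp_all add: Y.conv_alt comult multilinear ysym_counit_def lookup_add
        scl.scale_left_distrib)
    with unit show "\<exists>g. linear_map g \<and> g ysym_unit = ysym_unit \<and>
        (\<forall>x. Y.conv f g x = scl (ysym_counit x) ysym_unit)"
      using linear_lin_ext by blast
  qed
qed

theorem theorem4p1:
  "right_hopf_module ysym_mult ysym_unit ysym_comult ysym_counit msym_act msym_coact"
proof (intro right_hopf_module.intro hopf_algebra_ysym right_module.intro right_comodule.intro
    right_module_axioms.intro right_comodule_axioms.intro right_hopf_module_axioms.intro
    linear_msym_act linear_msym_coact msym_act_assoc msym_coassoc msym_coact_counit msym_coact_act)
  show "unital_algebra ysym_mult ysym_unit" "coalgebra ysym_comult ysym_counit"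
    using bialgebra_ysym by (simp_all add: bialgebra_def)
  show "msym_act (v \<otimes> ysym_unit) = v" for v
    by (rule injD [OF inj_push [OF inj_mlab]]) (simp add: push_msym_act ysym_unit_def)
qed

end
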